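(* Consider the $K$-cell uplink interfering multiple-access channel (IMAC) model described in the context, with $K\ge 2$ cells, $N$ single-antenna users per cell and $M$ receive antennas at each base station. Then for any number $N\ge 1$ of users per cell, the total number of degrees of freedom satisfies $$\mathrm{dof}_{\mathrm{total}}=\sum_{i=1}^{K}\sum_{j=1}^{N}d_j^{(i)}\le\frac{KNM}{N+1},$$ where $d_j^{(i)}$ denotes the degrees of freedom of user $j$ in cell $i$.
   Context: Model: there are $K$ cells, each with one base station (BS) equipped with $M$ receive antennas, serving $N$ single-antenna users; each BS is interested only in the messages of users in its own cell. For $i,k\in\{1,\dots,K\}$, $j\in\{1,\dots,N\}$, $\mathbf{h}_{i,j}^{(k)}\in\mathbb{C}^{M\times1}$ is the channel vector from user $j$ of cell $k$ to BS $i$, with i.i.d. zero-mean unit-variance circularly symmetric complex Gaussian entries, independent across $i,j,k$, time-invariant within a block. If users transmit symbols $x_j^{(k)}$, BS $i$ receives $\mathbf{y}_i=\sum_{k=1}^K\sum_j\mathbf{h}_{i,j}^{(k)}x_j^{(k)}+\mathbf{z}_i$, with $\mathbf z_i$ i.i.d. circularly symmetric complex Gaussian noise of variance $N_0$ per entry, and each user has average power constraint $\mathbb E[|x_j^{(i)}|^2]\le P$; $\mathrm{SNR}$ is the received signal-to-noise ratio. The degrees of freedom of user $j$ in cell $i$ are $d_j^{(i)}=\lim_{\mathrm{SNR}\to\infty}R_j^{(i)}(\mathrm{SNR})/\log\mathrm{SNR}$, where $(R_j^{(i)}(\mathrm{SNR}))$ is any achievable rate tuple (rates with vanishing error probability for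 the messages of all users). *)

theory Defs
  imports "HOL-Probability.Probability"
begin

text \<open>Indexing conventions: cells k, i range over {..<K}, users j over {..<N},
  antennas m over {..<M}, time slots t over {..<n}.
  Channel realisation H (i,k,j,m) = m-th entry of the channel vector from user j of
  cell k to base station i.\<close>

definition cgauss :: "real \<Rightarrow> complex measure" where
  "cgauss s = density lborel (\<lambda>z. ennreal (exp (- (cmod z)\<^sup>2 / s) / (pi * s)))"

definition channel_measure :: "nat \<Rightarrow> nat \<Rightarrow> nat \<Rightarrow> (nat \<times> nat \<times> nat \<times> nat \<Rightarrow> complex) measure" where
  "channel_measure K N M = PiM ({..<K} \<times> {..<K} \<times> {..<N} \<times> {..<M}) (\<lambda>_. cgauss 1)"

definition noise_measure :: "nat \<Rightarrow> nat \<Rightarrow> nat \<Rightarrow> real \<Rightarrow> (nat \<times> nat \<times> nat \<Rightarrow> complex) measure" where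
  "noise_measure K n M N0 = PiM ({..<K} \<times> {..<n} \<times> {..<M}) (\<lambda>_. cgauss N0)"

definition msg_tuples :: "nat \<Rightarrow> nat \<Rightarrow> (nat \<Rightarrow> nat \<Rightarrow> nat) \<Rightarrow> (nat \<Rightarrow> nat \<Rightarrow> nat) set" where
  "msg_tuples K N L = {w. \<forall>k j. if k < K \<and> j < N then w k j < L k j else w k j = 0}"

definition received ::
  "nat \<Rightarrow> nat \<Rightarrow> nat \<Rightarrow> nat \<Rightarrow> (nat \<times> nat \<times> nat \<times> nat \<Rightarrow> complex)
   \<Rightarrow> (nat \<Rightarrow> nat \<Rightarrow> nat \<Rightarrow> nat \<Rightarrow> complex) \<Rightarrow> (nat \<Rightarrow> nat \<Rightarrow> nat)
   \<Rightarrow> (nat \<times> nat \<times> nat \<Rightarrow> complex) \<Rightarrow> nat \<Rightarrow> (nat \<Rightarrow> nat \<Rightarrow> complex)" where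
  "received K N M n H f w z i = (\<lambda>t m. if t < n \<and> m < M then
      (\<Sum>k<K. \<Sum>j<N. H (i,k,j,m) * f k j (w k j) t) + z (i,t,m) else 0)"

definition error_event where
  "error_event K N M n N0 H f g w = {z \<in> space (noise_measure K n M N0).
      \<exists>i<K. \<exists>j<N. g i (received K N M n H f w z i) j \<noteq> w i j}"

definition is_code where
  "is_code K N M n P N0 H L f g \<longleftrightarrow>
     (\<forall>k<K. \<forall>j<N. L k j \<ge> 1) \<and>
     (\<forall>k<K. \<forall>j<N. (\<Sum>msg<L k j. \<Sum>t<n. (cmod (f k j msg t))\<^sup>2) \<le> real n * real (L k j) * P) \<and>
     (\<forall>w\<in>msg_tuples K N L. error_event K N M n N0 H f g w \<in> sets (noise_measure K n M N0))"

definition err_prob where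
  "err_prob K N M n N0 H L f g =
     (\<Sum>w\<in>msg_tuples K N L. measure (noise_measure K n M N0) (error_event K N M n N0 H f g w))
       / real (card (msg_tuples K N L))"

definition achievable_rates ::
  "nat \<Rightarrow> nat \<Rightarrow> nat \<Rightarrow> real \<Rightarrow> (nat \<times> nat \<times> nat \<times> nat \<Rightarrow> complex) \<Rightarrow> real
   \<Rightarrow> (nat \<Rightarrow> nat \<Rightarrow> real) \<Rightarrow> bool" where
  "achievable_rates K N M N0 H P R \<longleftrightarrow>
     (\<forall>k<K. \<forall>j<N. R k j \<ge> 0) \<and>
     (\<forall>\<epsilon>>0. \<exists>n0. \<forall>n\<ge>n0. \<exists>(L :: nat \<Rightarrow> nat \<Rightarrow> nat)
        (f :: nat \<Rightarrow> nat \<Rightarrow> nat \<Rightarrow> nat \<Rightarrow> complex)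
        (g :: nat \<Rightarrow> (nat \<Rightarrow> nat \<Rightarrow> complex) \<Rightarrow> nat \<Rightarrow> nat).
        is_code K N M n P N0 H L f g \<and>
        (\<forall>k<K. \<forall>j<N. real (L k j) \<ge> 2 powr (real n * R k j)) \<and>
        err_prob K N M n N0 H L f g \<le> \<epsilon>)"

definition dof_achievable ::
  "nat \<Rightarrow> nat \<Rightarrow> nat \<Rightarrow> real \<Rightarrow> (nat \<times> nat \<times> nat \<times> nat \<Rightarrow> complex)
   \<Rightarrow> (nat \<Rightarrow> nat \<Rightarrow> real) \<Rightarrow> bool" where
  "dof_achievable K N M N0 H d \<longleftrightarrow>
     (\<exists>R :: real \<Rightarrow> nat \<Rightarrow> nat \<Rightarrow> real.
        (\<forall>\<^sub>F P in at_top. achievable_rates K N M N0 H P (R P)) \<and>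
        (\<forall>k<K. \<forall>j<N. ((\<lambda>P. R P k j / log 2 (P / N0)) \<longlongrightarrow> d k j) at_top))"

end

theory Submission
  imports Defs "HOL-Real_Asymp.Real_Asymp"
begin

text \<open>Fix cells \<open>i \<noteq> k\<close> and a user \<open>l\<close> of cell \<open>k\<close>. Base station \<open>i\<close> decodes its own \<open>N\<close> users; after
  removing them (with all remaining users fixed) it sees user \<open>l\<close> of cell \<open>k\<close> through nonzero gains, hence,
  up to a bounded rescaling of the noise, as well as base station \<open>k\<close> does, and can decode that user as
  well. So \<open>N + 1\<close> users are decoded from \<open>M\<close> antennas. A sphere-packing comparison of Gaussian
  densities shows that at most \<open>2 (c P)^(n M)\<close> messages can be told apart in \<open>n\<close> slots, with \<open>c\<close> depending
  only on the channel, so that \<open>\<Sum>\<^sub>j d\<^sub>i\<^sub>j + d\<^sub>k\<^sub>l \<le> M\<close>. Summing over \<open>l\<close> and over \<open>i\<close> with \<open>k\<close> the cyclic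
  successor of \<open>i\<close> gives the claim.\<close>

section \<open>Circular complex Gaussian vectors\<close>

text \<open>Here \<open>s\<close> is the total variance, the mean of
  \<open>(cmod (z - a))\<^sup>2\<close>; the real and imaginary parts each carry
  \<open>s / 2\<close>.\<close>

definition cgauss_density :: "complex \<Rightarrow> real \<Rightarrow> complex \<Rightarrow> real" where
  "cgauss_density a s z = exp (- (cmod (z - a))\<^sup>2 / s) / (pi * s)"

text \<open>Coordinates are independent. The variance may depend on the coordinate because rescaling
  by different gains calls for a different amount of added noise in each.\<close>

definition gauss_vec :: "'j set \<Rightarrow> ('j \<Rightarrow> complex) \<Rightarrow> ('j \<Rightarrow> real) \<Rightarrow> ('j \<Rightarrow> complex) measure" where
  "gauss_vec J a s = PiM J (\<lambda>j. density lborel (\<lambda>z. ennreal (cgauss_density (a j) (s j) z)))"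

lemma cgauss_density_nonneg: "0 < s \<Longrightarrow> 0 \<le> cgauss_density a s z"
  by (simp add: cgauss_density_def)

lemma borel_measurable_cgauss_density [measurable (raw)]:
  assumes "f \<in> borel_measurable M" "g \<in> borel_measurable M"
  shows "(\<lambda>x. cgauss_density (f x) s (g x)) \<in> borel_measurable M"
  using assms unfolding cgauss_density_def by measurable

text \<open>The density factors into two real normal densities, one for each of \<open>Re\<close>
  and \<open>Im\<close>, with standard deviation \<open>r = sqrt (s / 2)\<close>.\<close>

lemma nn_integral_cgauss_density:
  assumes s: "0 < s"
  shows "(\<integral>\<^sup>+z. ennreal (cgauss_density a s z) \<partial>lborel) = 1"
proof -
  define r where "r = sqrt (s / 2)"
  have r: "r > 0" "r\<^sup>2 = s / 2" using s by (auto simp: r_def)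
  have sq: "sqrt (2 * pi * r\<^sup>2) * sqrt (2 * pi * r\<^sup>2) = pi * s"
    using s by (simp add: r(2))
  have "(\<integral>\<^sup>+z. ennreal (cgauss_density a s z) \<partial>lborel)
      = (\<integral>\<^sup>+z. (\<Prod>b\<in>Basis. ennreal (normal_density (a \<bullet> b) r (z \<bullet> b))) \<partial>lborel)"
  proof (intro nn_integral_cong)
    fix z :: complex
    have "(\<Prod>b\<in>Basis. normal_density (a \<bullet> b) r (z \<bullet> b))
        = normal_density (Re a) r (Re z) * normal_density (Im a) r (Im z)"
      by (simp add: Basis_complex_def)
    also have "\<dots> = exp (-(Re z - Re a)\<^sup>2 / s) * exp (-(Im z - Im a)\<^sup>2 / s)
        / (sqrt (2 * pi * r\<^sup>2) * sqrt (2 * pi * r\<^sup>2))"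
      by (simp add: normal_density_def r(2))
    also have "\<dots> = cgauss_density a s z"
      unfolding sq cgauss_density_def mult_exp_exp
      by (simp add: cmod_power2 diff_divide_distrib add_divide_distrib)
    finally show "ennreal (cgauss_density a s z)
        = (\<Prod>b\<in>Basis. ennreal (normal_density (a \<bullet> b) r (z \<bullet> b)))"
      by (simp add: prod_ennreal)
  qed
  also have "\<dots> = (\<Prod>b\<in>(Basis::complex set). (\<integral>\<^sup>+x. ennreal (normal_density (a \<bullet> b) r x) \<partial>lborel))"
    by (rule nn_integral_lborel_prod) auto
  also have "\<dots> = 1"
    using r by (simp add: nn_integral_eq_integral)
  finally show ?thesis .
qed

lemma prob_space_cgauss_density:
  "0 < s \<Longrightarrow> prob_space (density lborel (\<lambda>z. ennreal (cgauss_density a s z)))"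
  by (intro prob_spaceI) (simp add: emeasure_density nn_integral_cgauss_density)

lemma cgauss_eq_density: "cgauss s = density lborel (\<lambda>z. ennreal (cgauss_density 0 s z))"
  by (simp add: cgauss_def cgauss_density_def)

lemma prob_space_cgauss: "0 < s \<Longrightarrow> prob_space (cgauss s)"
  by (simp add: cgauss_eq_density prob_space_cgauss_density)

lemma AE_cgauss_nonzero: "AE z in cgauss s. z \<noteq> 0"
  unfolding cgauss_eq_density
  by (subst AE_density) (use AE_lborel_singleton[of "0::complex"] in \<open>auto elim: eventually_mono\<close>)

text \<open>Completing the square.\<close>
lemma cgauss_density_mult:
  fixes T :: complex
  assumes "0 < s" "0 < b"
  defines "t \<equiv> b + s * (cmod T)\<^sup>2"
  shows "cgauss_density (e + T * z) b y * cgauss_density a s z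
       = cgauss_density (e + T * a) t y *
         cgauss_density (a + of_real (s / t) * cnj T * (y - e - T * a)) (s * b / t) z"
proof -
  have t: "t > 0" using assms by (simp add: add_pos_nonneg)
  define u where "u = y - e - T * a"
  define x where "x = z - a"
  have 1: "y - (e + T * z) = u - T * x" "y - (e + T * a) = u"
       "z - (a + of_real (s / t) * cnj T * (y - e - T * a)) = x - of_real (s / t) * cnj T * u"
    by (simp_all add: u_def x_def algebra_simps)
  define q where "q = (cmod T)\<^sup>2"
  have "(cmod (u - T * x))\<^sup>2 = (cmod u)\<^sup>2 + q * (cmod x)\<^sup>2 - 2 * Re (u * cnj T * cnj x)"
    unfolding q_def cmod_power2 by (simp add: power2_eq_square algebra_simps)
  moreover have "(cmod (x - of_real r * cnj T * u))\<^sup>2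
      = (cmod x)\<^sup>2 + r\<^sup>2 * q * (cmod u)\<^sup>2 - 2 * r * Re (u * cnj T * cnj x)" for r
    unfolding q_def cmod_power2 by (simp add: power2_eq_square algebra_simps)
  \<comment> \<open>The exponents agree as an identity between reals, with \<open>U\<close> and
    \<open>X\<close> standing for the squared moduli of \<open>u\<close> and \<open>x\<close>, and
    \<open>R\<close> for the real cross term.\<close>
  moreover have "(U + q * X - 2 * R) / b + X / s
      = U / t + (X + (s / t)\<^sup>2 * q * U - 2 * (s / t) * R) / (s * b / t)" for U X R :: real
  proof -
    have "(X + (s / t)\<^sup>2 * q * U - 2 * (s / t) * R) / (s * b / t)
        = (t * X) / (s * b) + s * q * U / (t * b) - 2 * R / b"
      using t assms(1,2) by (simp add: field_simps power2_eq_square)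
    moreover have "t * X / (s * b) = X / s + q * X / b"
      using assms(1,2) by (simp add: t_def q_def field_simps)
    moreover have "U / t + s * q * U / (t * b) = U / b"
    proof -
      have "U / t + s * q * U / (t * b) = (U * (b + s * q)) / (t * b)"
        using t assms(1,2) by (simp add: field_simps)
      also have "\<dots> = U / b" using t by (simp add: t_def q_def)
      finally show ?thesis .
    qed
    ultimately show ?thesis by (simp add: diff_divide_distrib add_divide_distrib)
  qed
  ultimately have ex: "(cmod (u - T * x))\<^sup>2 / b + (cmod x)\<^sup>2 / s
     = (cmod u)\<^sup>2 / t + (cmod (x - of_real (s / t) * cnj T * u))\<^sup>2 / (s * b / t)"
    by (simp only:)
  have "cgauss_density (e + T * z) b y * cgauss_density a s z
      = exp (- ((cmod (u - T * x))\<^sup>2 / b + (cmod x)\<^sup>2 / s)) / (pi * pi * (b * s))"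
    unfolding cgauss_density_def 1 x_def[symmetric] by (simp add: exp_diff exp_minus field_simps)
  also have "\<dots> = exp (- (cmod u)\<^sup>2 / t) / (pi * t) *
     (exp (- (cmod (x - of_real (s / t) * cnj T * u))\<^sup>2 / (s * b / t)) / (pi * (s * b / t)))"
    unfolding ex minus_add_distrib exp_add using t assms(1,2) by (simp add: field_simps)
  finally show ?thesis unfolding cgauss_density_def 1 .
qed

text \<open>In the product from completing the square, the first factor does not involve
  \<open>z\<close> and the second is a normalised density in \<open>z\<close>. Thus scaling a
  Gaussian by \<open>T\<close> and adding independent noise adds the variances
  \<open>s * (cmod T)\<^sup>2\<close> and \<open>b\<close>.\<close>

lemma cgauss_density_convolution:
  assumes "0 < s" "0 < b"
  shows "(\<integral>\<^sup>+z. ennreal (cgauss_density (e + T * z) b y) * ennreal (cgauss_density a s z) \<partial>lborel)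
       = ennreal (cgauss_density (e + T * a) (b + s * (cmod T)\<^sup>2) y)"
proof -
  define t where "t = b + s * (cmod T)\<^sup>2"
  have t: "t > 0" using assms by (simp add: t_def add_pos_nonneg)
  have "(\<integral>\<^sup>+z. ennreal (cgauss_density (e + T * z) b y) * ennreal (cgauss_density a s z) \<partial>lborel)
      = (\<integral>\<^sup>+z. ennreal (cgauss_density (e + T * a) t y) *
         ennreal (cgauss_density (a + of_real (s / t) * cnj T * (y - e - T * a)) (s * b / t) z) \<partial>lborel)"
    using assms t unfolding t_def
    by (intro nn_integral_cong)
       (simp only: ennreal_mult'[symmetric] cgauss_density_nonneg cgauss_density_mult)
  also have "\<dots> = ennreal (cgauss_density (e + T * a) t y)"
    using assms t by (simp add: nn_integral_cmult nn_integral_cgauss_density)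
  finally show ?thesis by (simp add: t_def)
qed

text \<open>A Gaussian at least twice as wide dominates a narrow one with another centre. The price
  is \<open>v / s\<close> for the normalisation and an exponential in the squared displacement;
  \<open>2 * s \<le> v\<close> absorbs the factor 2 in the squared triangle inequality.\<close>

lemma cgauss_density_le:
  assumes s: "0 < s" and v: "2 * s \<le> v"
  shows "cgauss_density a s z \<le> v / s * exp (2 * (cmod (a - c))\<^sup>2 / v) * cgauss_density c v z"
proof -
  have v0: "v > 0" using assms by simp
  have "cmod (z - c) \<le> cmod (z - a) + cmod (a - c)"
    using norm_triangle_ineq[of "z - a" "a - c"] by simp
  then have "(cmod (z - c))\<^sup>2 \<le> (cmod (z - a) + cmod (a - c))\<^sup>2"
    by (intro power_mono) auto
  also have "\<dots> \<le> 2 * (cmod (z - a))\<^sup>2 + 2 * (cmod (a - c))\<^sup>2"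
    using sum_squares_ge_zero[of "cmod (z - a) - cmod (a - c)" 0]
    by (simp add: power2_eq_square algebra_simps)
  finally have "(cmod (z - c))\<^sup>2 / v \<le> (2 * (cmod (z - a))\<^sup>2 + 2 * (cmod (a - c))\<^sup>2) / v"
    using v0 by (intro divide_right_mono) auto
  moreover have "2 * (cmod (z - a))\<^sup>2 / v \<le> (cmod (z - a))\<^sup>2 / s"
    using mult_right_mono[OF v, of "(cmod (z - a))\<^sup>2"] s v0 by (simp add: field_simps)
  ultimately have "- (cmod (z - a))\<^sup>2 / s \<le> 2 * (cmod (a - c))\<^sup>2 / v + - (cmod (z - c))\<^sup>2 / v"
    by (simp add: add_divide_distrib)
  then have "exp (- (cmod (z - a))\<^sup>2 / s)
      \<le> exp (2 * (cmod (a - c))\<^sup>2 / v) * exp (- (cmod (z - c))\<^sup>2 / v)"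
    by (simp add: exp_add[symmetric])
  then show ?thesis
    using s v0 by (simp add: cgauss_density_def field_simps)
qed

section \<open>Gaussian product measures: densities, smoothing, change of measure\<close>

lemma sets_gauss_vec: "sets (gauss_vec J a s) = sets (PiM J (\<lambda>_. borel))"
  unfolding gauss_vec_def by (intro sets_PiM_cong) auto

lemma space_gauss_vec: "space (gauss_vec J a s) = (\<Pi>\<^sub>E j\<in>J. UNIV)"
  unfolding gauss_vec_def by (simp add: space_PiM)

lemma prob_space_gauss_vec:
  "(\<And>j. j \<in> J \<Longrightarrow> 0 < s j) \<Longrightarrow> prob_space (gauss_vec J a s)"
  unfolding gauss_vec_def by (intro prob_space_PiM prob_space_cgauss_density)

lemma gauss_vec_eq_density:
  assumes "finite J" "\<And>j. j \<in> J \<Longrightarrow> 0 < s j"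
  shows "gauss_vec J a s =
    density (PiM J (\<lambda>_. lborel)) (\<lambda>y. \<Prod>j\<in>J. ennreal (cgauss_density (a j) (s j) (y j)))"
proof -
  \<comment> \<open>The product locale asks for a sigma-finite factor at every index, so the
    variance is set to 1 outside \<open>J\<close>.\<close>
  define s' where "s' = (\<lambda>j. if j \<in> J then s j else 1)"
  have s': "0 < s' j" for j using assms by (simp add: s'_def)
  let ?M = "\<lambda>j. density lborel (\<lambda>z. ennreal (cgauss_density (a j) (s' j) z))"
  interpret product_sigma_finite ?M
    by (intro product_sigma_finite.intro prob_space_imp_sigma_finite prob_space_cgauss_density s')
  interpret L: product_sigma_finite "\<lambda>_::'a. lborel :: complex measure" ..
  have "gauss_vec J a s = PiM J ?M"
    unfolding gauss_vec_def by (intro PiM_cong) (auto simp: s'_def)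
  moreover have "density (PiM J (\<lambda>_. lborel)) (\<lambda>y. \<Prod>j\<in>J. ennreal (cgauss_density (a j) (s j) (y j)))
    = PiM J ?M"
  proof (intro PiM_eqI assms(1))
    fix A :: "'a \<Rightarrow> complex set"
    assume A: "\<And>j. j \<in> J \<Longrightarrow> A j \<in> sets (?M j)"
    then have A': "\<And>j. j \<in> J \<Longrightarrow> A j \<in> sets borel" by simp
    have "emeasure (density (PiM J (\<lambda>_. lborel)) (\<lambda>y. \<Prod>j\<in>J. ennreal (cgauss_density (a j) (s j) (y j)))) (Pi\<^sub>E J A)
      = (\<integral>\<^sup>+y. (\<Prod>j\<in>J. ennreal (cgauss_density (a j) (s j) (y j))) * indicator (Pi\<^sub>E J A) y \<partial>PiM J (\<lambda>_. lborel))"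
      using A' assms(1) by (intro emeasure_density) (auto intro!: sets_PiM_I_finite)
    also have "\<dots> = (\<integral>\<^sup>+y. (\<Prod>j\<in>J. ennreal (cgauss_density (a j) (s j) (y j)) * indicator (A j) (y j)) \<partial>PiM J (\<lambda>_. lborel))"
    proof (intro nn_integral_cong)
      fix y :: "'a \<Rightarrow> complex" assume "y \<in> space (PiM J (\<lambda>_. lborel))"
      then have "indicator (Pi\<^sub>E J A) y = (\<Prod>j\<in>J. indicator (A j) (y j) :: ennreal)"
        using assms(1) by (auto simp: space_PiM PiE_iff indicator_def prod_zero_iff)
      then show "(\<Prod>j\<in>J. ennreal (cgauss_density (a j) (s j) (y j))) * indicator (Pi\<^sub>E J A) y =
          (\<Prod>j\<in>J. ennreal (cgauss_density (a j) (s j) (y j)) * indicator (A j) (y j))"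
        by (simp add: prod.distrib)
    qed
    also have "\<dots> = (\<Prod>j\<in>J. \<integral>\<^sup>+z. ennreal (cgauss_density (a j) (s j) z) * indicator (A j) z \<partial>lborel)"
      using A' by (intro L.product_nn_integral_prod assms(1)) auto
    also have "\<dots> = (\<Prod>j\<in>J. emeasure (?M j) (A j))"
      using A' by (intro prod.cong refl) (simp add: emeasure_density s'_def)
    finally show "emeasure (density (PiM J (\<lambda>_. lborel)) (\<lambda>y. \<Prod>j\<in>J. ennreal (cgauss_density (a j) (s j) (y j)))) (Pi\<^sub>E J A)
      = (\<Prod>j\<in>J. emeasure (?M j) (A j))" .
  qed (simp cong: sets_PiM_cong)
  ultimately show ?thesis by simp
qed

lemma emeasure_gauss_vec:
  assumes "finite J" "\<And>j. j \<in> J \<Longrightarrow> 0 < s j" "S \<in> sets (PiM J (\<lambda>_. borel))"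
  shows "emeasure (gauss_vec J a s) S =
    (\<integral>\<^sup>+y. (\<Prod>j\<in>J. ennreal (cgauss_density (a j) (s j) (y j))) * indicator S y \<partial>PiM J (\<lambda>_. lborel))"
proof -
  have "sets (PiM J (\<lambda>_. lborel)) = sets (PiM J (\<lambda>_. borel :: complex measure))"
    by (intro sets_PiM_cong) auto
  with assms show ?thesis
    by (subst gauss_vec_eq_density) (auto intro!: emeasure_density)
qed

text \<open>The probability is an integral of a density depending measurably on \<open>y\<close>.
  This allows the chance of a correct guess to be integrated as a function of the received
  vector.\<close>

lemma borel_measurable_emeasure_gauss_vec:
  assumes J: "finite J" and b: "\<And>j. j \<in> J \<Longrightarrow> 0 < b j" and S: "S \<in> sets (PiM J (\<lambda>_. borel))"
  shows "(\<lambda>y. emeasure (gauss_vec J (\<lambda>j. e j + T j * y j) b) S)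
    \<in> borel_measurable (PiM J (\<lambda>_. borel))"
proof -
  interpret L: product_sigma_finite "\<lambda>_::'a. lborel :: complex measure" ..
  interpret finite_product_sigma_finite "\<lambda>_::'a. lborel :: complex measure" J
    by standard (rule J)
  have [measurable]: "S \<in> sets (PiM J (\<lambda>_. lborel))"
    using S by (simp cong: sets_PiM_cong)
  have "emeasure (gauss_vec J x b) S =
      (\<integral>\<^sup>+v. (\<Prod>j\<in>J. ennreal (cgauss_density (x j) (b j) (v j))) * indicator S v \<partial>PiM J (\<lambda>_. lborel))" for x
    using J b S by (rule emeasure_gauss_vec)
  then show ?thesis by simp
qed

text \<open>Tonelli exchanges the signal and the added noise; the inner integral then factors over
  \<open>J\<close> into one-dimensional convolutions.\<close>

lemma gauss_vec_smoothing:
  assumes J: "finite J" and s: "\<And>j. j \<in> J \<Longrightarrow> 0 < s j" and b: "\<And>j. j \<in> J \<Longrightarrow> 0 < b j"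
    and S: "S \<in> sets (PiM J (\<lambda>_. borel))"
  shows "(\<integral>\<^sup>+y. emeasure (gauss_vec J (\<lambda>j. e j + T j * y j) b) S \<partial>gauss_vec J a s)
    = emeasure (gauss_vec J (\<lambda>j. e j + T j * a j) (\<lambda>j. b j + s j * (cmod (T j))\<^sup>2)) S"
proof -
  let ?L = "PiM J (\<lambda>_. lborel :: complex measure)"
  interpret L: product_sigma_finite "\<lambda>_::'a. lborel :: complex measure" ..
  interpret finite_product_sigma_finite "\<lambda>_::'a. lborel :: complex measure" J
    by standard (rule J)
  interpret pair_sigma_finite ?L ?L ..
  have [measurable]: "S \<in> sets ?L"
    using S by (simp cong: sets_PiM_cong)
  let ?d = "\<lambda>a s y. \<Prod>j\<in>J. ennreal (cgauss_density (a j) (s j) (y j))"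
  have "(\<integral>\<^sup>+y. emeasure (gauss_vec J (\<lambda>j. e j + T j * y j) b) S \<partial>gauss_vec J a s)
     = (\<integral>\<^sup>+y. ?d a s y * (\<integral>\<^sup>+v. ?d (\<lambda>j. e j + T j * y j) b v * indicator S v \<partial>?L) \<partial>?L)"
  proof -
    have "emeasure (gauss_vec J x b) S = (\<integral>\<^sup>+v. ?d x b v * indicator S v \<partial>?L)" for x
      using J b S by (rule emeasure_gauss_vec)
    moreover have "gauss_vec J a s = density ?L (?d a s)"
      using J s by (rule gauss_vec_eq_density)
    ultimately show ?thesis by (simp add: nn_integral_density)
  qed
  also have "\<dots> = (\<integral>\<^sup>+y. (\<integral>\<^sup>+v. ?d a s y * (?d (\<lambda>j. e j + T j * y j) b v * indicator S v) \<partial>?L) \<partial>?L)"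
    by (subst nn_integral_cmult) auto
  also have "\<dots> = (\<integral>\<^sup>+v. (\<integral>\<^sup>+y. ?d a s y * (?d (\<lambda>j. e j + T j * y j) b v * indicator S v) \<partial>?L) \<partial>?L)"
    by (rule Fubini') measurable
  also have "\<dots> = (\<integral>\<^sup>+v. (\<integral>\<^sup>+y. (\<Prod>j\<in>J. ennreal (cgauss_density (e j + T j * y j) (b j) (v j)) *
         ennreal (cgauss_density (a j) (s j) (y j))) \<partial>?L) * indicator S v \<partial>?L)"
    by (intro nn_integral_cong, subst nn_integral_multc[symmetric])
       (auto simp: prod.distrib mult_ac)
  also have "\<dots> = (\<integral>\<^sup>+v. (\<Prod>j\<in>J. \<integral>\<^sup>+z. ennreal (cgauss_density (e j + T j * z) (b j) (v j)) *
         ennreal (cgauss_density (a j) (s j) z) \<partial>lborel) * indicator S v \<partial>?L)"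
    by (subst L.product_nn_integral_prod[OF J]) auto
  also have "\<dots> = (\<integral>\<^sup>+v. ?d (\<lambda>j. e j + T j * a j) (\<lambda>j. b j + s j * (cmod (T j))\<^sup>2) v * indicator S v \<partial>?L)"
    using s b by (simp add: cgauss_density_convolution)
  also have "\<dots> = emeasure (gauss_vec J (\<lambda>j. e j + T j * a j) (\<lambda>j. b j + s j * (cmod (T j))\<^sup>2)) S"
    using s b by (intro emeasure_gauss_vec[symmetric] J S)
      (simp add: add_pos_nonneg less_imp_le)
  finally show ?thesis .
qed

text \<open>The pointwise domination is multiplied over \<open>J\<close>. The displacement bound
  allows \<open>v / 2\<close> per coordinate on average, so the exponential factors together cost at
  most \<open>exp 1 ^ card J\<close>.\<close>

lemma nn_integral_gauss_vec_le:
  assumes J: "finite J" and s: "0 < s" and v: "2 * s \<le> v"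
    and f: "f \<in> borel_measurable (PiM J (\<lambda>_. borel))"
    and le: "(\<Sum>j\<in>J. (cmod (a j - c j))\<^sup>2) \<le> real (card J) * v / 2"
  shows "(\<integral>\<^sup>+y. f y \<partial>gauss_vec J a (\<lambda>_. s))
    \<le> ennreal ((exp 1 * v / s) ^ card J) * (\<integral>\<^sup>+y. f y \<partial>gauss_vec J c (\<lambda>_. v))"
proof -
  let ?L = "PiM J (\<lambda>_. lborel :: complex measure)"
  let ?C = "(exp 1 * v / s) ^ card J"
  have v0: "v > 0" using s v by simp
  have [measurable]: "f \<in> borel_measurable ?L"
    using f by (simp cong: measurable_cong_sets sets_PiM_cong)
  have *: "(\<Prod>j\<in>J. cgauss_density (a j) s (y j)) \<le> ?C * (\<Prod>j\<in>J. cgauss_density (c j) v (y j))" for y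
  proof -
    have "(\<Prod>j\<in>J. cgauss_density (a j) s (y j))
       \<le> (\<Prod>j\<in>J. v / s * exp (2 * (cmod (a j - c j))\<^sup>2 / v) * cgauss_density (c j) v (y j))"
      using s v by (intro prod_mono conjI cgauss_density_nonneg cgauss_density_le)
    also have "\<dots> = (v / s) ^ card J * exp (2 * (\<Sum>j\<in>J. (cmod (a j - c j))\<^sup>2) / v)
        * (\<Prod>j\<in>J. cgauss_density (c j) v (y j))"
      by (simp only: prod.distrib prod_constant exp_sum[OF J] sum_divide_distrib sum_distrib_left)
    also have "\<dots> \<le> (v / s) ^ card J * exp (real (card J)) * (\<Prod>j\<in>J. cgauss_density (c j) v (y j))"
      using s v0 le
      by (intro mult_right_mono mult_left_mono prod_nonneg ballI cgauss_density_nonneg)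
         (auto simp: field_simps)
    also have "exp (real (card J)) = exp 1 ^ card J"
      by (simp add: exp_of_nat_mult[symmetric])
    finally show ?thesis by (simp add: power_mult_distrib power_divide field_simps)
  qed
  have "(\<integral>\<^sup>+y. f y \<partial>gauss_vec J a (\<lambda>_. s))
      = (\<integral>\<^sup>+y. (\<Prod>j\<in>J. ennreal (cgauss_density (a j) s (y j))) * f y \<partial>?L)"
    using s by (subst gauss_vec_eq_density[OF J]) (auto simp: nn_integral_density)
  also have "\<dots> \<le> (\<integral>\<^sup>+y. ennreal ?C * ((\<Prod>j\<in>J. ennreal (cgauss_density (c j) v (y j))) * f y) \<partial>?L)"
  proof (intro nn_integral_mono)
    fix y
    have "(\<Prod>j\<in>J. ennreal (cgauss_density (a j) s (y j)))
        \<le> ennreal (?C * (\<Prod>j\<in>J. cgauss_density (c j) v (y j)))"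
      using * s by (simp add: prod_ennreal cgauss_density_nonneg ennreal_leI)
    also have "\<dots> = ennreal ?C * (\<Prod>j\<in>J. ennreal (cgauss_density (c j) v (y j)))"
      using s v0 by (simp add: prod_ennreal cgauss_density_nonneg ennreal_mult prod_nonneg)
    finally show "(\<Prod>j\<in>J. ennreal (cgauss_density (a j) s (y j))) * f y
        \<le> ennreal ?C * ((\<Prod>j\<in>J. ennreal (cgauss_density (c j) v (y j))) * f y)"
      by (simp add: mult.assoc[symmetric] mult_right_mono)
  qed
  also have "\<dots> = ennreal ?C * (\<integral>\<^sup>+y. f y \<partial>gauss_vec J c (\<lambda>_. v))"
    using v0 by (subst gauss_vec_eq_density[OF J]) (auto simp: nn_integral_density nn_integral_cmult)
  finally show ?thesis .
qed

section \<open>Joint decoding by two receivers\<close>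

lemma ennreal_add_le_one_plus_mult:
  fixes x y :: ennreal
  assumes "x \<le> 1" "y \<le> 1"
  shows "x + y \<le> 1 + x * y"
proof -
  obtain a where a: "x = ennreal a" "0 \<le> a" "a \<le> 1"
    using assms(1) by (cases x) (auto simp: top_unique)
  obtain b where b: "y = ennreal b" "0 \<le> b" "b \<le> 1"
    using assms(2) by (cases y) (auto simp: top_unique)
  have "0 \<le> (1 - a) * (1 - b)" using a b by simp
  then have "ennreal (a + b) \<le> ennreal (1 + a * b)"
    by (intro ennreal_leI) (simp add: algebra_simps)
  then show ?thesis using a b by (simp add: ennreal_mult)
qed

text \<open>Receiver 1 observes \<open>y\<close> with the smaller noise variance \<open>s\<close>. Adding fresh noise of variance
  \<open>N0 - s\<close> reproduces the original first channel, so \<open>k1\<close> below is the law of the guess for \<open>\<rho> w\<close>;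
  once \<open>\<rho> w\<close> is known, rescaling by \<open>T\<close>, shifting by \<open>e (\<rho> w)\<close> and topping up the noise reproduces the
  second channel, so \<open>k2\<close> is the law of the guess for \<open>\<tau> w\<close>. The products \<open>k1 * k2\<close> sum to at most 1,
  and each codeword's density is dominated by a multiple of one common Gaussian density.\<close>
lemma two_stage_decoding_bound:
  fixes F :: "'w set" and \<rho> :: "'w \<Rightarrow> 'r" and \<tau> :: "'w \<Rightarrow> 't"
  assumes F: "finite F" and J: "finite J" and inj: "inj_on (\<lambda>w. (\<rho> w, \<tau> w)) F"
    and s: "0 < s" "s < N0" "\<And>j. j \<in> J \<Longrightarrow> s * (cmod (T j))\<^sup>2 < N0" and v: "2 * s \<le> v"
    and G: "\<And>r. r \<in> \<rho> ` F \<Longrightarrow> G r \<in> sets (PiM J (\<lambda>_. borel))" "disjoint_family_on G (\<rho> ` F)"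
    and G': "\<And>t. t \<in> \<tau> ` F \<Longrightarrow> G' t \<in> sets (PiM J (\<lambda>_. borel))" "disjoint_family_on G' (\<tau> ` F)"
    and a': "\<And>w j. w \<in> F \<Longrightarrow> j \<in> J \<Longrightarrow> a' w j = e (\<rho> w) j + T j * a w j"
    and power: "\<And>w. w \<in> F \<Longrightarrow> (\<Sum>j\<in>J. (cmod (a w j - c j))\<^sup>2) \<le> real (card J) * v / 2"
  shows "(\<Sum>w\<in>F. measure (gauss_vec J (a w) (\<lambda>_. N0)) (G (\<rho> w))
      + measure (gauss_vec J (a' w) (\<lambda>_. N0)) (G' (\<tau> w)) - 1) \<le> (exp 1 * v / s) ^ card J"
proof -
  define C where "C = (exp 1 * v / s) ^ card J"
  have v0: "v > 0" and N0: "N0 > 0" and C0: "C \<ge> 0" using s v by (auto simp: C_def)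
  let ?M = "PiM J (\<lambda>_. borel :: complex measure)"
  define b where "b = (\<lambda>j. N0 - s * (cmod (T j))\<^sup>2)"
  have b: "b j > 0" if "j \<in> J" for j using s(3)[OF that] by (simp add: b_def)
  \<comment> \<open>The mean is written \<open>0 + 1 * y j\<close> to be the instance of the
    smoothing lemma with shift 0 and scale 1.\<close>
  define k1 where "k1 = (\<lambda>r y. emeasure (gauss_vec J (\<lambda>j. 0 + 1 * y j) (\<lambda>_. N0 - s)) (G r))"
  define k2 where "k2 = (\<lambda>r t y. emeasure (gauss_vec J (\<lambda>j. e r j + T j * y j) b) (G' t))"
  have m1 [measurable]: "k1 (\<rho> w) \<in> borel_measurable ?M" if "w \<in> F" for w
    unfolding k1_def using s that by (intro borel_measurable_emeasure_gauss_vec J G) auto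
  have m2 [measurable]: "k2 (\<rho> w) (\<tau> w) \<in> borel_measurable ?M" if "w \<in> F" for w
    unfolding k2_def using b that by (intro borel_measurable_emeasure_gauss_vec J G') auto
  have p1: "prob_space (gauss_vec J x (\<lambda>_. N0 - s))" for x
    using s by (intro prob_space_gauss_vec) auto
  have p2: "prob_space (gauss_vec J x b)" for x
    using b by (intro prob_space_gauss_vec) auto
  have pN: "prob_space (gauss_vec J x (\<lambda>_. N0))" for x
    using N0 by (intro prob_space_gauss_vec) auto
  have ps: "prob_space (gauss_vec J x (\<lambda>_. s))" for x
    using s by (intro prob_space_gauss_vec) auto
  have pv: "prob_space (gauss_vec J c (\<lambda>_. v))"
    using v0 by (intro prob_space_gauss_vec) auto
  have k_le: "k1 r y \<le> 1" "k2 r t y \<le> 1" for r t y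
    unfolding k1_def k2_def by (rule prob_space.emeasure_le_1, rule p1 p2)+
  \<comment> \<open>By injectivity the sum runs over distinct pairs, and may be enlarged to the full
    product of the two images. For fixed \<open>y\<close> and \<open>r\<close> the events
    \<open>G' t\<close> are disjoint, so the inner sum is at most 1; then the same holds for the
    events \<open>G r\<close>.\<close>
  have sum_le: "(\<Sum>w\<in>F. k1 (\<rho> w) y * k2 (\<rho> w) (\<tau> w) y) \<le> 1" for y
  proof -
    have "(\<Sum>w\<in>F. k1 (\<rho> w) y * k2 (\<rho> w) (\<tau> w) y)
        = (\<Sum>(r, t)\<in>(\<lambda>w. (\<rho> w, \<tau> w)) ` F. k1 r y * k2 r t y)"
      using inj by (simp add: sum.reindex)
    also have "\<dots> \<le> (\<Sum>(r, t)\<in>\<rho> ` F \<times> \<tau> ` F. k1 r y * k2 r t y)"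
      using F by (intro sum_mono2) auto
    also have "\<dots> = (\<Sum>r\<in>\<rho> ` F. k1 r y * (\<Sum>t\<in>\<tau> ` F. k2 r t y))"
      using F by (simp add: sum.cartesian_product[symmetric] sum_distrib_left)
    also have "\<dots> \<le> (\<Sum>r\<in>\<rho> ` F. k1 r y * 1)"
    proof (intro sum_mono mult_left_mono)
      fix r
      have "(\<Sum>t\<in>\<tau> ` F. k2 r t y)
          = emeasure (gauss_vec J (\<lambda>j. e r j + T j * y j) b) (\<Union>t\<in>\<tau> ` F. G' t)"
        unfolding k2_def using F G' by (intro sum_emeasure) (auto simp: sets_gauss_vec)
      also have "\<dots> \<le> 1" by (rule prob_space.emeasure_le_1, rule p2)
      finally show "(\<Sum>t\<in>\<tau> ` F. k2 r t y) \<le> 1" .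
    qed auto
    also have "\<dots> = emeasure (gauss_vec J (\<lambda>j. 0 + 1 * y j) (\<lambda>_. N0 - s)) (\<Union>r\<in>\<rho> ` F. G r)"
      unfolding k1_def mult_1_right using F G by (intro sum_emeasure) (auto simp: sets_gauss_vec)
    also have "\<dots> \<le> 1" by (rule prob_space.emeasure_le_1, rule p1)
    finally show ?thesis .
  qed
  have each: "emeasure (gauss_vec J (a w) (\<lambda>_. N0)) (G (\<rho> w))
      + emeasure (gauss_vec J (a' w) (\<lambda>_. N0)) (G' (\<tau> w))
      \<le> 1 + ennreal C * (\<integral>\<^sup>+y. k1 (\<rho> w) y * k2 (\<rho> w) (\<tau> w) y \<partial>gauss_vec J c (\<lambda>_. v))"
    if w: "w \<in> F" for w
  proof -
    let ?A = "gauss_vec J (a w) (\<lambda>_. s)"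
    have [measurable_cong]: "sets ?A = sets ?M" by (rule sets_gauss_vec)
    note [measurable] = m1[OF w] m2[OF w]
    have "emeasure (gauss_vec J (a w) (\<lambda>_. N0)) (G (\<rho> w)) = (\<integral>\<^sup>+y. k1 (\<rho> w) y \<partial>?A)"
      unfolding k1_def using s w by (subst gauss_vec_smoothing[OF J]) (auto intro!: G)
    moreover have "emeasure (gauss_vec J (a' w) (\<lambda>_. N0)) (G' (\<tau> w)) = (\<integral>\<^sup>+y. k2 (\<rho> w) (\<tau> w) y \<partial>?A)"
    proof -
      have "gauss_vec J (a' w) (\<lambda>_. N0)
          = gauss_vec J (\<lambda>j. e (\<rho> w) j + T j * a w j) (\<lambda>j. b j + s * (cmod (T j))\<^sup>2)"
        unfolding gauss_vec_def using a'[OF w] by (intro PiM_cong) (auto simp: b_def)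
      then show ?thesis
        unfolding k2_def using s b w by (subst gauss_vec_smoothing[OF J]) (auto intro!: G')
    qed
    ultimately have "emeasure (gauss_vec J (a w) (\<lambda>_. N0)) (G (\<rho> w))
      + emeasure (gauss_vec J (a' w) (\<lambda>_. N0)) (G' (\<tau> w))
      = (\<integral>\<^sup>+y. k1 (\<rho> w) y + k2 (\<rho> w) (\<tau> w) y \<partial>?A)"
      by (simp add: nn_integral_add)
    \<comment> \<open>Since \<open>(1 - k1) * (1 - k2)\<close> is nonnegative, the sum of the two
      chances of success is traded for their product, the quantity controlled by
      \<open>sum_le\<close>.\<close>
    also have "\<dots> \<le> (\<integral>\<^sup>+y. 1 + k1 (\<rho> w) y * k2 (\<rho> w) (\<tau> w) y \<partial>?A)"
      by (intro nn_integral_mono ennreal_add_le_one_plus_mult k_le)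
    also have "\<dots> = 1 + (\<integral>\<^sup>+y. k1 (\<rho> w) y * k2 (\<rho> w) (\<tau> w) y \<partial>?A)"
      by (simp add: nn_integral_add prob_space.emeasure_space_1[OF ps])
    also have "\<dots> \<le> 1 + ennreal C * (\<integral>\<^sup>+y. k1 (\<rho> w) y * k2 (\<rho> w) (\<tau> w) y \<partial>gauss_vec J c (\<lambda>_. v))"
      unfolding C_def using power[OF w]
      by (intro add_left_mono nn_integral_gauss_vec_le J s v) measurable
    finally show ?thesis .
  qed
  have [measurable_cong]: "sets (gauss_vec J c (\<lambda>_. v)) = sets ?M" by (rule sets_gauss_vec)
  \<comment> \<open>Subtraction in \<open>ennreal\<close> truncates, so the \<open>- 1\<close> of
    each summand is carried on the right as \<open>card F\<close> until the inequality is back in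
    the reals.\<close>
  have "ennreal (\<Sum>w\<in>F. measure (gauss_vec J (a w) (\<lambda>_. N0)) (G (\<rho> w))
      + measure (gauss_vec J (a' w) (\<lambda>_. N0)) (G' (\<tau> w)))
    = (\<Sum>w\<in>F. emeasure (gauss_vec J (a w) (\<lambda>_. N0)) (G (\<rho> w))
      + emeasure (gauss_vec J (a' w) (\<lambda>_. N0)) (G' (\<tau> w)))"
    by (simp add: sum_ennreal[symmetric] ennreal_plus prob_space.finite_measure[OF pN] finite_measure.emeasure_eq_measure)
  also have "\<dots> \<le> (\<Sum>w\<in>F. 1 + ennreal C * (\<integral>\<^sup>+y. k1 (\<rho> w) y * k2 (\<rho> w) (\<tau> w) y \<partial>gauss_vec J c (\<lambda>_. v)))"
    by (intro sum_mono each)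
  also have "\<dots> = of_nat (card F) + ennreal C * (\<integral>\<^sup>+y. (\<Sum>w\<in>F. k1 (\<rho> w) y * k2 (\<rho> w) (\<tau> w) y) \<partial>gauss_vec J c (\<lambda>_. v))"
    by (subst nn_integral_sum) (auto simp: sum.distrib sum_distrib_left)
  also have "\<dots> \<le> of_nat (card F) + ennreal C * (\<integral>\<^sup>+y. 1 \<partial>gauss_vec J c (\<lambda>_. v))"
    by (intro add_left_mono mult_left_mono nn_integral_mono sum_le) auto
  also have "\<dots> = ennreal (real (card F) + C)"
    using C0 by (simp add: prob_space.emeasure_space_1[OF pv] ennreal_of_nat_eq_real_of_nat)
  finally have "(\<Sum>w\<in>F. measure (gauss_vec J (a w) (\<lambda>_. N0)) (G (\<rho> w))
      + measure (gauss_vec J (a' w) (\<lambda>_. N0)) (G' (\<tau> w))) \<le> real (card F) + C"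
    using C0 by (subst (asm) ennreal_le_iff) auto
  then show ?thesis by (simp add: sum_subtractf C_def)
qed

section \<open>Decoding regions and message tuples\<close>

text \<open>Translation invariance of Lebesgue measure turns a shift of the noise into a shift of
  the mean.\<close>

lemma emeasure_cgauss_density_shift:
  assumes [measurable]: "A \<in> sets borel"
  shows "emeasure (density lborel (\<lambda>z. ennreal (cgauss_density 0 s z))) {z. a + z \<in> A}
    = emeasure (density lborel (\<lambda>z. ennreal (cgauss_density a s z))) A"
proof -
  have "emeasure (density lborel (\<lambda>z. ennreal (cgauss_density a s z))) A
     = (\<integral>\<^sup>+z. ennreal (cgauss_density a s z) * indicator A z \<partial>distr lborel borel ((+) a))"
    by (simp add: emeasure_density lborel_distr_plus)
  also have "\<dots> = (\<integral>\<^sup>+z. ennreal (cgauss_density 0 s z) * indicator {z. a + z \<in> A} z \<partial>lborel)"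
    by (subst nn_integral_distr) (auto simp: cgauss_density_def indicator_def intro!: nn_integral_cong)
  also have "\<dots> = emeasure (density lborel (\<lambda>z. ennreal (cgauss_density 0 s z))) {z. a + z \<in> A}"
    by (subst emeasure_density) auto
  finally show ?thesis by simp
qed

lemma distr_gauss_vec_shift:
  assumes J: "finite J" and s: "0 < s"
  shows "distr (gauss_vec J (\<lambda>_. 0) (\<lambda>_. s)) (PiM J (\<lambda>_. borel)) (\<lambda>z. \<lambda>j\<in>J. a j + z j)
    = gauss_vec J a (\<lambda>_. s)"
proof -
  let ?M = "\<lambda>a::'a \<Rightarrow> complex. \<lambda>j. density lborel (\<lambda>z. ennreal (cgauss_density (a j) s z))"
  interpret A: product_sigma_finite "?M a"
    using s by (intro product_sigma_finite.intro prob_space_imp_sigma_finite prob_space_cgauss_density)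
  interpret Z: product_sigma_finite "?M (\<lambda>_. 0)"
    using s by (intro product_sigma_finite.intro prob_space_imp_sigma_finite prob_space_cgauss_density)
  have m: "(\<lambda>z. \<lambda>j\<in>J. a j + z j) \<in> gauss_vec J (\<lambda>_. 0) (\<lambda>_. s) \<rightarrow>\<^sub>M PiM J (\<lambda>_. borel)"
    unfolding measurable_cong_sets[OF sets_gauss_vec refl] by measurable
  show ?thesis
    unfolding gauss_vec_def[of J a]
  proof (rule A.PiM_eqI[OF J])
    fix A :: "'a \<Rightarrow> complex set" assume "\<And>j. j \<in> J \<Longrightarrow> A j \<in> sets (?M a j)"
    then have A [measurable]: "\<And>j. j \<in> J \<Longrightarrow> A j \<in> sets borel" by simp
    have "emeasure (distr (gauss_vec J (\<lambda>_. 0) (\<lambda>_. s)) (PiM J (\<lambda>_. borel)) (\<lambda>z. \<lambda>j\<in>J. a j + z j)) (Pi\<^sub>E J A)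
      = emeasure (gauss_vec J (\<lambda>_. 0) (\<lambda>_. s)) (\<Pi>\<^sub>E j\<in>J. {z. a j + z \<in> A j})"
      using A J by (subst emeasure_distr[OF m])
        (auto simp: space_gauss_vec PiE_iff intro!: sets_PiM_I_finite arg_cong2[where f=emeasure])
    also have "\<dots> = (\<Prod>j\<in>J. emeasure (?M (\<lambda>_. 0) j) {z. a j + z \<in> A j})"
      unfolding gauss_vec_def using J by (intro Z.emeasure_PiM) auto
    also have "\<dots> = (\<Prod>j\<in>J. emeasure (?M a j) (A j))"
      by (intro prod.cong refl emeasure_cgauss_density_shift A)
    finally show "emeasure (distr (gauss_vec J (\<lambda>_. 0) (\<lambda>_. s)) (PiM J (\<lambda>_. borel)) (\<lambda>z. \<lambda>j\<in>J. a j + z j)) (Pi\<^sub>E J A)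
      = (\<Prod>j\<in>J. emeasure (?M a j) (A j))" .
  qed (simp cong: sets_PiM_cong)
qed

section \<open>Noise at one base station and its decoding regions\<close>

lemma sets_noise_measure: "sets (noise_measure K n M N0) = sets (PiM ({..<K} \<times> {..<n} \<times> {..<M}) (\<lambda>_. borel))"
  unfolding noise_measure_def by (intro sets_PiM_cong) (auto simp: cgauss_def)

lemma space_noise_measure: "space (noise_measure K n M N0) = (\<Pi>\<^sub>E _\<in>{..<K} \<times> {..<n} \<times> {..<M}. UNIV)"
  unfolding noise_measure_def by (simp add: space_PiM cgauss_def)

lemma prob_space_noise_measure: "0 < N0 \<Longrightarrow> prob_space (noise_measure K n M N0)"
  unfolding noise_measure_def by (intro prob_space_PiM prob_space_cgauss)

text \<open>Projecting the joint noise onto the coordinates of station \<open>i\<close> leaves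
  independent Gaussians on \<open>J\<close>, which are then shifted by the signal.\<close>

lemma distr_noise_measure:
  fixes n M :: nat
  assumes i: "i < K" and N0: "0 < N0"
  defines "J \<equiv> {..<n} \<times> {..<M}"
  shows "distr (noise_measure K n M N0) (PiM J (\<lambda>_. borel)) (\<lambda>z. \<lambda>p\<in>J. a p + z (i, p))
    = gauss_vec J a (\<lambda>_. N0)"
proof -
  let ?D = "distr (noise_measure K n M N0) (PiM J (\<lambda>_. cgauss N0)) (\<lambda>z. \<lambda>p\<in>J. z (i, p))"
  have "?D = PiM J (\<lambda>_. cgauss N0)"
    unfolding noise_measure_def using i N0
    by (intro distr_PiM_reindex prob_space_cgauss) (auto simp: J_def inj_on_def)
  then have "?D = gauss_vec J (\<lambda>_. 0) (\<lambda>_. N0)"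
    by (simp add: gauss_vec_def cgauss_eq_density)
  then have "gauss_vec J a (\<lambda>_. N0) = distr ?D (PiM J (\<lambda>_. borel)) (\<lambda>z. \<lambda>p\<in>J. a p + z p)"
    using N0 by (simp add: distr_gauss_vec_shift J_def)
  also have "\<dots> = distr (noise_measure K n M N0) (PiM J (\<lambda>_. borel))
      ((\<lambda>z. \<lambda>p\<in>J. a p + z p) \<circ> (\<lambda>z. \<lambda>p\<in>J. z (i, p)))"
  proof (rule distr_distr)
    show "(\<lambda>z. \<lambda>p\<in>J. a p + z p) \<in> PiM J (\<lambda>_. cgauss N0) \<rightarrow>\<^sub>M PiM J (\<lambda>_. borel)"
      by (subst measurable_cong_sets[where M'="PiM J (\<lambda>_. borel)"])
         (auto intro!: sets_PiM_cong simp: cgauss_def)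
    show "(\<lambda>z. \<lambda>p\<in>J. z (i, p)) \<in> noise_measure K n M N0 \<rightarrow>\<^sub>M PiM J (\<lambda>_. cgauss N0)"
      unfolding noise_measure_def using i by (auto intro!: measurable_restrict measurable_component_singleton simp: J_def)
  qed
  also have "(\<lambda>z. \<lambda>p\<in>J. a p + z p) \<circ> (\<lambda>z. \<lambda>p\<in>J. z (i, p)) = (\<lambda>z. \<lambda>p\<in>J. a p + z (i, p))"
    by (auto simp: fun_eq_iff restrict_def)
  finally show ?thesis ..
qed

text \<open>The noiseless part of \<open>received\<close>, with slot and antenna packed into the
  pair \<open>p\<close> so that it can serve as the mean of a \<open>gauss_vec\<close>.\<close>

definition signal where
  "signal K N H f w i p = (\<Sum>k<K. \<Sum>j<N. H (i, k, j, snd p) * f k j (w k j) (fst p))"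

text \<open>The zero padding copies that of \<open>received\<close>, so the result is exactly the
  kind of argument a decoder \<open>g i\<close> takes.\<close>

definition block :: "nat \<Rightarrow> nat \<Rightarrow> (nat \<times> nat \<Rightarrow> complex) \<Rightarrow> nat \<Rightarrow> nat \<Rightarrow> complex" where
  "block n M y = (\<lambda>t m. if t < n \<and> m < M then y (t, m) else 0)"

text \<open>The measurability hypothesis of a code concerns all base stations jointly, so the
  correct-decoding region of a single one is recovered as a section of the joint event.\<close>
lemma decoding_region:
  fixes N0 :: real and w :: "nat \<Rightarrow> nat \<Rightarrow> nat"
  assumes i: "i < K" and N0: "0 < N0"
    and E: "error_event K N M n N0 H f g w \<in> sets (noise_measure K n M N0)"
  obtains S where "S \<in> sets (PiM ({..<n} \<times> {..<M}) (\<lambda>_. borel))"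
    "\<And>y j. y \<in> S \<Longrightarrow> j < N \<Longrightarrow> g i (block n M y) j = w i j"
    "1 - measure (noise_measure K n M N0) (error_event K N M n N0 H f g w)
      \<le> measure (gauss_vec ({..<n} \<times> {..<M}) (signal K N H f w i) (\<lambda>_. N0)) S"
proof -
  let ?W = "noise_measure K n M N0" and ?E = "error_event K N M n N0 H f g w"
  let ?I = "{..<K} \<times> {..<n} \<times> {..<M}"
  define J where "J = {..<n} \<times> {..<M}"
  define a where "a = signal K N H f w i"
  interpret prob_space ?W using N0 by (rule prob_space_noise_measure)
  define Z where "Z = space ?W - ?E"
  have Z: "Z \<in> sets ?W" using E by (simp add: Z_def)
  have PZ: "measure ?W Z = 1 - measure ?W ?E"
    unfolding Z_def using E by (simp add: prob_compl)
  have inZ: "z \<in> Z \<longleftrightarrow> z \<in> space ?W \<and> (\<forall>i'<K. \<forall>j<N. g i' (received K N M n H f w z i') j = w i' j)" for z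
    by (auto simp: Z_def error_event_def)
  show ?thesis
  \<comment> \<open>If no noise decodes correctly, the bound to be met is 0 and the empty region
    suffices.\<close>
  proof (cases "Z = {}")
    case True
    then have "1 - measure ?W ?E = 0" using PZ by simp
    then show ?thesis by (intro that[of "{}"]) auto
  next
    case False
    then obtain z0 where z0: "z0 \<in> Z" by auto
    \<comment> \<open>The section: station \<open>i\<close> gets the noise that produces
      \<open>y\<close>, every other station keeps its noise from the correctly decoded
      \<open>z0\<close>.\<close>
    define u where "u = (\<lambda>y. \<lambda>q\<in>?I. if fst q = i then y (snd q) - a (snd q) else z0 q)"
    have u: "u \<in> PiM J (\<lambda>_. borel) \<rightarrow>\<^sub>M ?W"
      unfolding measurable_cong_sets[OF refl sets_noise_measure] u_def
    proof (rule measurable_restrict)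
      fix q assume q: "q \<in> ?I"
      then have [measurable]: "(\<lambda>y. y (snd q)) \<in> PiM J (\<lambda>_. borel) \<rightarrow>\<^sub>M (borel :: complex measure)"
        by (intro measurable_component_singleton) (auto simp: J_def)
      show "(\<lambda>y. if fst q = i then y (snd q) - a (snd q) else z0 q) \<in> PiM J (\<lambda>_. borel) \<rightarrow>\<^sub>M borel"
        by measurable
    qed
    define S where "S = u -` Z \<inter> space (PiM J (\<lambda>_. borel))"
    have S: "S \<in> sets (PiM J (\<lambda>_. borel))"
      unfolding S_def using u Z by (rule measurable_sets)
    have ri: "received K N M n H f w (u y) i = block n M y" for y
      using i by (auto simp: received_def block_def u_def a_def signal_def fun_eq_iff)
    have ro: "received K N M n H f w (u y) i' = received K N M n H f w z0 i'" if "i' < K" "i' \<noteq> i" for y i'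
      using that by (auto simp: received_def u_def fun_eq_iff)
    \<comment> \<open>Replacing the noise of the other stations by that of \<open>z0\<close> keeps a
      good noise vector good, so \<open>Z\<close> lies in the preimage of the section
      \<open>S\<close>.\<close>
    have "measure ?W Z \<le> measure ?W ((\<lambda>z. \<lambda>p\<in>J. a p + z (i, p)) -` S \<inter> space ?W)"
    proof (rule finite_measure_mono)
      show "Z \<subseteq> (\<lambda>z. \<lambda>p\<in>J. a p + z (i, p)) -` S \<inter> space ?W"
      proof
        fix z assume z: "z \<in> Z"
        let ?y = "\<lambda>p\<in>J. a p + z (i, p)"
        have "block n M ?y = received K N M n H f w z i"
          by (auto simp: block_def received_def J_def a_def signal_def fun_eq_iff)
        then have "\<forall>i'<K. \<forall>j<N. g i' (received K N M n H f w (u ?y) i') j = w i' j"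
          using z z0 inZ ri[of ?y] ro by metis
        moreover have "u ?y \<in> space ?W" by (simp add: u_def space_noise_measure)
        ultimately have "u ?y \<in> Z" using inZ by blast
        then show "z \<in> (\<lambda>z. \<lambda>p\<in>J. a p + z (i, p)) -` S \<inter> space ?W"
          using z inZ by (auto simp: S_def space_PiM)
      qed
      show "(\<lambda>z. \<lambda>p\<in>J. a p + z (i, p)) -` S \<inter> space ?W \<in> sets ?W"
      proof (rule measurable_sets[OF _ S])
        show "(\<lambda>z. \<lambda>p\<in>J. a p + z (i, p)) \<in> ?W \<rightarrow>\<^sub>M PiM J (\<lambda>_. borel)"
          unfolding measurable_cong_sets[OF sets_noise_measure refl] using i
          by (auto intro!: measurable_restrict borel_measurable_add measurable_component_singleton simp: J_def)
      qed
    qed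
    also have "\<dots> = measure (distr ?W (PiM J (\<lambda>_. borel)) (\<lambda>z. \<lambda>p\<in>J. a p + z (i, p))) S"
    proof (rule measure_distr[symmetric, OF _ S])
      show "(\<lambda>z. \<lambda>p\<in>J. a p + z (i, p)) \<in> ?W \<rightarrow>\<^sub>M PiM J (\<lambda>_. borel)"
        unfolding measurable_cong_sets[OF sets_noise_measure refl] using i
        by (auto intro!: measurable_restrict borel_measurable_add measurable_component_singleton simp: J_def)
    qed
    also have "\<dots> = measure (gauss_vec J a (\<lambda>_. N0)) S"
      using distr_noise_measure[OF i N0, of n M a] by (simp add: J_def)
    finally have "1 - measure ?W ?E \<le> measure (gauss_vec J a (\<lambda>_. N0)) S" using PZ by simp
    moreover have "g i (block n M y) j = w i j" if "y \<in> S" "j < N" for y j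
      using that i inZ[of "u y"] ri[of y] by (auto simp: S_def)
    ultimately show ?thesis using S by (intro that[of S]) (auto simp: J_def a_def)
  qed
qed

section \<open>Uniformly distributed message tuples\<close>

lemma bij_betw_msg_tuples:
  "bij_betw (\<lambda>w. \<lambda>p\<in>{..<K} \<times> {..<N}. w (fst p) (snd p)) (msg_tuples K N L)
     (\<Pi>\<^sub>E p\<in>{..<K} \<times> {..<N}. {..<L (fst p) (snd p)})"
  by (rule bij_betw_byWitness[where f' = "\<lambda>x k j. if k < K \<and> j < N then x (k, j) else 0"])
     (auto simp: msg_tuples_def fun_eq_iff PiE_iff extensional_def split: if_splits)

lemma finite_msg_tuples: "finite (msg_tuples K N L)"
  by (subst bij_betw_finite[OF bij_betw_msg_tuples]) (auto intro!: finite_PiE)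

lemma card_msg_tuples: "card (msg_tuples K N L) = (\<Prod>k<K. \<Prod>j<N. L k j)"
proof -
  have "card (msg_tuples K N L) = (\<Prod>p\<in>{..<K} \<times> {..<N}. L (fst p) (snd p))"
    by (subst bij_betw_same_card[OF bij_betw_msg_tuples]) (simp add: card_PiE)
  then show ?thesis by (simp add: prod.cartesian_product case_prod_unfold)
qed

text \<open>Each message of a single user occurs in equally many tuples. This carries the power
  constraint, an average over one user's codebook, to an average over all tuples; it is multiplied
  out to avoid division.\<close>

lemma sum_msg_tuples_marginal:
  fixes \<phi> :: "nat \<Rightarrow> real"
  assumes k: "k < K" and j: "j < N"
  shows "real (L k j) * (\<Sum>w\<in>msg_tuples K N L. \<phi> (w k j))
    = real (card (msg_tuples K N L)) * (\<Sum>m<L k j. \<phi> m)"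
proof -
  let ?\<Omega> = "msg_tuples K N L"
  define c where "c = card {w \<in> ?\<Omega>. w k j = 0}"
  \<comment> \<open>Overwriting the entry \<open>(k, j)\<close> by 0 or by \<open>m\<close> is a
    bijection between the two slices.\<close>
  have slice: "card {w \<in> ?\<Omega>. w k j = m} = c" if "m < L k j" for m
    unfolding c_def
  proof (rule bij_betw_same_card, rule bij_betw_byWitness[where f = "\<lambda>w. w(k := (w k)(j := 0))"
        and f' = "\<lambda>w. w(k := (w k)(j := m))"])
    have "0 < L k j" using that by simp
    then show "(\<lambda>w. w(k := (w k)(j := 0))) ` {w \<in> ?\<Omega>. w k j = m} \<subseteq> {w \<in> ?\<Omega>. w k j = 0}"
      unfolding msg_tuples_def by fastforce
  qed (use that k j in \<open>auto simp: msg_tuples_def fun_eq_iff split: if_splits\<close>)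
  have group: "(\<Sum>w\<in>?\<Omega>. \<psi> (w k j)) = real c * (\<Sum>m<L k j. \<psi> m)" for \<psi> :: "nat \<Rightarrow> real"
  proof -
    have "(\<Sum>w\<in>?\<Omega>. \<psi> (w k j)) = (\<Sum>m<L k j. \<Sum>w\<in>{w \<in> ?\<Omega>. w k j = m}. \<psi> (w k j))"
      using k j by (intro sum.group[symmetric] finite_msg_tuples) (auto simp: msg_tuples_def)
    also have "\<dots> = (\<Sum>m<L k j. real c * \<psi> m)"
      by (intro sum.cong refl) (simp add: slice)
    finally show ?thesis by (simp add: sum_distrib_left)
  qed
  have "real (card ?\<Omega>) = real c * real (L k j)"
    using group[of "\<lambda>_. 1"] by simp
  with group[of \<phi>] show ?thesis by simp
qed

section \<open>Counting codewords\<close>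

text \<open>The active users are those of cell \<open>i\<close> together with user \<open>l\<close> of cell \<open>k\<close>; the contribution of
  all other users is held fixed and only recentres the received vectors.\<close>
definition active :: "nat \<Rightarrow> nat \<Rightarrow> nat \<Rightarrow> nat \<Rightarrow> nat \<Rightarrow> bool" where
  "active i k l k' j \<longleftrightarrow> k' = i \<or> k' = k \<and> j = l"

definition background where
  "background K N i k l H f w i' p =
     (\<Sum>k'<K. \<Sum>j<N. if active i k l k' j then 0 else H (i', k', j, snd p) * f k' j (w k' j) (fst p))"

text \<open>Because \<open>i \<noteq> k\<close>, the two kinds of active users are disjoint, and
  each term of the double sum falls into exactly one of three groups.\<close>

lemma signal_split:
  assumes "i < K" "k < K" "i \<noteq> k" "l < N"
  shows "signal K N H f w i' p = background K N i k l H f w i' p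
    + (\<Sum>j<N. H (i', i, j, snd p) * f i j (w i j) (fst p)) + H (i', k, l, snd p) * f k l (w k l) (fst p)"
proof -
  define x where "x k' j = H (i', k', j, snd p) * f k' j (w k' j) (fst p)" for k' j
  have "x k' j = (if active i k l k' j then 0 else x k' j) + (if k' = i then x i j else 0)
      + (if k' = k then if j = l then x k l else 0 else 0)" for k' j
    using assms(3) by (auto simp: active_def)
  then have "(\<Sum>k'<K. \<Sum>j<N. x k' j) = (\<Sum>k'<K. \<Sum>j<N. (if active i k l k' j then 0 else x k' j)
      + (if k' = i then x i j else 0) + (if k' = k then if j = l then x k l else 0 else 0))"
    by (intro sum.cong refl)
  also have "\<dots> = (\<Sum>k'<K. \<Sum>j<N. if active i k l k' j then 0 else x k' j)
      + (\<Sum>k'<K. \<Sum>j<N. if k' = i then x i j else 0)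
      + (\<Sum>k'<K. \<Sum>j<N. if k' = k then if j = l then x k l else 0 else 0)"
    by (simp only: sum.distrib)
  also have "(\<Sum>k'<K. \<Sum>j<N. if k' = i then x i j else 0) = (\<Sum>j<N. x i j)"
    using assms by (subst sum.swap) simp
  also have "(\<Sum>k'<K. \<Sum>j<N. if k' = k then if j = l then x k l else 0 else 0) = x k l"
    using assms by (subst sum.swap) simp
  finally show ?thesis unfolding signal_def background_def x_def .
qed

text \<open>Codebook size 1 forces an active user's message to be 0, so the modified tuples encode
  the choices of the inactive users alone.\<close>

lemma card_msg_tuples_active:
  assumes "i < K" "k < K" "i \<noteq> k" "l < N"
  shows "card (msg_tuples K N L)
    = card (msg_tuples K N (\<lambda>k' j. if active i k l k' j then 1 else L k' j)) * ((\<Prod>j<N. L i j) * L k l)"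
proof -
  have "L k' j = (if active i k l k' j then 1 else L k' j) * (if k' = i then L i j else 1)
      * (if k' = k then if j = l then L k l else 1 else 1)" for k' j
    using assms(3) by (auto simp: active_def)
  then have "(\<Prod>k'<K. \<Prod>j<N. L k' j) = (\<Prod>k'<K. \<Prod>j<N. (if active i k l k' j then 1 else L k' j)
      * (if k' = i then L i j else 1) * (if k' = k then if j = l then L k l else 1 else 1))"
    by (intro prod.cong refl)
  also have "\<dots> = (\<Prod>k'<K. \<Prod>j<N. if active i k l k' j then 1 else L k' j)
      * (\<Prod>k'<K. \<Prod>j<N. if k' = i then L i j else 1)
      * (\<Prod>k'<K. \<Prod>j<N. if k' = k then if j = l then L k l else 1 else 1)"
    by (simp only: prod.distrib)
  also have "(\<Prod>k'<K. \<Prod>j<N. if k' = i then L i j else 1) = (\<Prod>j<N. L i j)"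
    using assms by (subst prod.swap) simp
  also have "(\<Prod>k'<K. \<Prod>j<N. if k' = k then if j = l then L k l else 1 else 1) = L k l"
    using assms by (subst prod.swap) simp
  finally show ?thesis by (simp add: card_msg_tuples mult.assoc)
qed

text \<open>The energy of the active users at station \<open>i\<close>, that is, the squared
  displacement from the common centre \<open>background\<close> in the Gaussian comparison.\<close>

definition deviation where
  "deviation K N M n i k l H f w =
     (\<Sum>p\<in>{..<n} \<times> {..<M}. (cmod (signal K N H f w i p - background K N i k l H f w i p))\<^sup>2)"

text \<open>Every user spends energy at most \<open>n * P\<close> on average over the tuples.
  Cauchy-Schwarz over the own cell gives the \<open>(real N)\<^sup>2\<close>, the outside user the
  \<open>+ 1\<close>, separating the two the factor 2, and each of the \<open>M\<close> antennas
  sees the same symbols.\<close>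

lemma sum_deviation_le:
  assumes idx: "i < K" "k < K" "i \<noteq> k" "l < N"
    and code: "is_code K N M n P N0 H L f g"
    and h: "\<And>j m. j < N \<Longrightarrow> m < M \<Longrightarrow> cmod (H (i, i, j, m)) \<le> h" "\<And>m. m < M \<Longrightarrow> cmod (H (i, k, l, m)) \<le> h"
  shows "(\<Sum>w\<in>msg_tuples K N L. deviation K N M n i k l H f w)
    \<le> real (card (msg_tuples K N L)) * (real (n * M) * (2 * h\<^sup>2 * ((real N)\<^sup>2 + 1) * P))"
proof -
  let ?\<Omega> = "msg_tuples K N L"
  define e where "e k' j w = (\<Sum>t<n. (cmod (f k' j (w k' j) t))\<^sup>2)" for k' j and w :: "nat \<Rightarrow> nat \<Rightarrow> nat"
  have pw: "(\<Sum>w\<in>?\<Omega>. e k' j w) \<le> real (card ?\<Omega>) * (real n * P)" if "k' < K" "j < N" for k' j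
  proof -
    have "L k' j \<ge> 1" using code that unfolding is_code_def by blast
    then have L: "real (L k' j) > 0" by simp
    have "real (L k' j) * (\<Sum>w\<in>?\<Omega>. e k' j w) = real (card ?\<Omega>) * (\<Sum>m<L k' j. \<Sum>t<n. (cmod (f k' j m t))\<^sup>2)"
      unfolding e_def using that by (rule sum_msg_tuples_marginal)
    also have "\<dots> \<le> real (card ?\<Omega>) * (real n * real (L k' j) * P)"
    proof (rule mult_left_mono)
      show "(\<Sum>m<L k' j. \<Sum>t<n. (cmod (f k' j m t))\<^sup>2) \<le> real n * real (L k' j) * P"
        using code that unfolding is_code_def by blast
    qed simp
    finally have "real (L k' j) * (\<Sum>w\<in>?\<Omega>. e k' j w) \<le> real (L k' j) * (real (card ?\<Omega>) * (real n * P))"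
      by (simp only: mult_ac)
    then show ?thesis using L by simp
  qed
  have term_le: "(cmod (H q * z))\<^sup>2 \<le> h\<^sup>2 * (cmod z)\<^sup>2" if "cmod (H q) \<le> h" for q z
    using that by (simp add: norm_mult power_mult_distrib mult_right_mono power_mono)
  have dev: "deviation K N M n i k l H f w
      \<le> real M * (2 * h\<^sup>2 * (real N * (\<Sum>j<N. e i j w) + e k l w))" for w
  proof -
    have "deviation K N M n i k l H f w \<le> (\<Sum>p\<in>{..<n} \<times> {..<M}.
        2 * h\<^sup>2 * (real N * (\<Sum>j<N. (cmod (f i j (w i j) (fst p)))\<^sup>2) + (cmod (f k l (w k l) (fst p)))\<^sup>2))"
      unfolding deviation_def
    proof (rule sum_mono)
      fix p assume p: "p \<in> {..<n} \<times> {..<M}"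
      let ?x = "\<lambda>j. H (i, i, j, snd p) * f i j (w i j) (fst p)"
      let ?y = "H (i, k, l, snd p) * f k l (w k l) (fst p)"
      have "cmod ((\<Sum>j<N. ?x j) + ?y) \<le> (\<Sum>j<N. cmod (?x j)) + cmod ?y"
        by (intro order.trans[OF norm_triangle_ineq] add_right_mono norm_sum)
      then have "(cmod ((\<Sum>j<N. ?x j) + ?y))\<^sup>2 \<le> ((\<Sum>j<N. cmod (?x j)) + cmod ?y)\<^sup>2"
        by (intro power_mono) auto
      \<comment> \<open>The square of the difference of the two summands is nonnegative.\<close>
      also have "\<dots> \<le> 2 * (\<Sum>j<N. cmod (?x j))\<^sup>2 + 2 * (cmod ?y)\<^sup>2"
        using sum_squares_ge_zero[of "(\<Sum>j<N. cmod (?x j)) - cmod ?y" 0]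
        by (simp add: power2_eq_square algebra_simps)
      also have "\<dots> \<le> 2 * (h\<^sup>2 * (real N * (\<Sum>j<N. (cmod (f i j (w i j) (fst p)))\<^sup>2)))
          + 2 * (h\<^sup>2 * (cmod (f k l (w k l) (fst p)))\<^sup>2)"
      proof -
        have "(\<Sum>j<N. cmod (?x j))\<^sup>2 \<le> (\<Sum>j<N. (cmod (?x j))\<^sup>2) * real N"
          using sum_squared_le_sum_of_squares[of "\<lambda>j. cmod (?x j)" "{..<N}"] by simp
        also have "\<dots> \<le> (\<Sum>j<N. h\<^sup>2 * (cmod (f i j (w i j) (fst p)))\<^sup>2) * real N"
          using p h(1) by (intro mult_right_mono sum_mono term_le) auto
        also have "\<dots> = h\<^sup>2 * (real N * (\<Sum>j<N. (cmod (f i j (w i j) (fst p)))\<^sup>2))"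
          by (simp add: sum_distrib_left[symmetric])
        finally have "(\<Sum>j<N. cmod (?x j))\<^sup>2 \<le> h\<^sup>2 * (real N * (\<Sum>j<N. (cmod (f i j (w i j) (fst p)))\<^sup>2))" .
        moreover have "(cmod ?y)\<^sup>2 \<le> h\<^sup>2 * (cmod (f k l (w k l) (fst p)))\<^sup>2"
          using p h(2) by (intro term_le) auto
        ultimately show ?thesis by linarith
      qed
      finally have "(cmod ((\<Sum>j<N. ?x j) + ?y))\<^sup>2 \<le> 2 * h\<^sup>2 * (real N * (\<Sum>j<N. (cmod (f i j (w i j) (fst p)))\<^sup>2)
          + (cmod (f k l (w k l) (fst p)))\<^sup>2)"
        by (simp add: distrib_left mult.assoc)
      then show "(cmod (signal K N H f w i p - background K N i k l H f w i p))\<^sup>2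
         \<le> 2 * h\<^sup>2 * (real N * (\<Sum>j<N. (cmod (f i j (w i j) (fst p)))\<^sup>2) + (cmod (f k l (w k l) (fst p)))\<^sup>2)"
        using signal_split[OF idx, of H f w i p] by (simp add: algebra_simps)
    qed
    also have "\<dots> = (\<Sum>t<n. \<Sum>m<M. 2 * h\<^sup>2 * (real N * (\<Sum>j<N. (cmod (f i j (w i j) t))\<^sup>2) + (cmod (f k l (w k l) t))\<^sup>2))"
      by (simp only: sum.cartesian_product case_prod_unfold)
    also have "\<dots> = real M * (2 * h\<^sup>2 * (real N * (\<Sum>t<n. \<Sum>j<N. (cmod (f i j (w i j) t))\<^sup>2) + e k l w))"
      by (simp add: e_def sum_distrib_left[symmetric] sum.distrib)
    also have "(\<Sum>t<n. \<Sum>j<N. (cmod (f i j (w i j) t))\<^sup>2) = (\<Sum>j<N. e i j w)"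
      unfolding e_def by (rule sum.swap)
    finally show ?thesis .
  qed
  have "(\<Sum>w\<in>?\<Omega>. deviation K N M n i k l H f w)
      \<le> (\<Sum>w\<in>?\<Omega>. real M * (2 * h\<^sup>2 * (real N * (\<Sum>j<N. e i j w) + e k l w)))"
    by (intro sum_mono dev)
  also have "\<dots> = real M * (2 * h\<^sup>2 * (real N * (\<Sum>w\<in>?\<Omega>. \<Sum>j<N. e i j w) + (\<Sum>w\<in>?\<Omega>. e k l w)))"
    by (simp add: sum_distrib_left[symmetric] sum.distrib)
  also have "\<dots> = real M * (2 * h\<^sup>2 * (real N * (\<Sum>j<N. \<Sum>w\<in>?\<Omega>. e i j w) + (\<Sum>w\<in>?\<Omega>. e k l w)))"
    by (subst sum.swap) simp
  also have "\<dots> \<le> real M * (2 * h\<^sup>2 * (real N * (\<Sum>j<N. real (card ?\<Omega>) * (real n * P)) + real (card ?\<Omega>) * (real n * P)))"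
    using idx by (intro mult_left_mono add_mono sum_mono pw) auto
  also have "\<dots> = real (card ?\<Omega>) * (real (n * M) * (2 * h\<^sup>2 * ((real N)\<^sup>2 + 1) * P))"
    by (simp add: power2_eq_square algebra_simps)
  finally show ?thesis .
qed

text \<open>Per fibre of the inactive messages, codewords whose deviation exceeds four times its average bound are
  discarded: the term \<open>X w / D\<close> exceeds 1 exactly on those and sums to at most a quarter of the
  number of message tuples.\<close>
lemma code_size_bound:
  fixes N0 P h s :: real
  assumes idx: "i < K" "k < K" "i \<noteq> k" "l < N"
    and code: "is_code K N M n P N0 H L f g" and err: "err_prob K N M n N0 H L f g \<le> 1 / 8"
    and h: "\<And>j m. j < N \<Longrightarrow> m < M \<Longrightarrow> cmod (H (i, i, j, m)) \<le> h" "\<And>m. m < M \<Longrightarrow> cmod (H (i, k, l, m)) \<le> h"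
    and nz: "\<And>m. m < M \<Longrightarrow> H (i, k, l, m) \<noteq> 0"
    and s: "0 < s" "s < N0" "\<And>m. m < M \<Longrightarrow> s * (cmod (H (k, k, l, m) / H (i, k, l, m)))\<^sup>2 < N0"
    and v_def: "v = 16 * h\<^sup>2 * ((real N)\<^sup>2 + 1) * P" and v: "2 * s \<le> v"
  shows "(\<Prod>j<N. real (L i j)) * real (L k l) \<le> 2 * (exp 1 * v / s) ^ (n * M)"
proof -
  let ?\<Omega> = "msg_tuples K N L"
  define J where "J = {..<n} \<times> {..<M}"
  have J: "finite J" and cJ: "card J = n * M" by (auto simp: J_def)
  define C where "C = (exp 1 * v / s) ^ (n * M)"
  have N0: "0 < N0" and v0: "0 < v" using s(1,2) v by auto
  define p where "p w = measure (noise_measure K n M N0) (error_event K N M n N0 H f g w)" for w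
  define X where "X = deviation K N M n i k l H f"
  \<comment> \<open>By the choice of the constant 16 in \<open>v\<close>, this is four times the
    bound on the average deviation.\<close>
  define D where "D = real (card J) * v / 2"
  define L' where "L' k' j = (if active i k l k' j then 1 else L k' j)" for k' j
  \<comment> \<open>Erasing the active messages leaves the inactive ones, so the fibres of
    \<open>\<zeta>\<close> are the sets of tuples with the inactive messages fixed.\<close>
  define \<zeta> where "\<zeta> w = (\<lambda>k' j. if active i k l k' j then 0 else w k' j)" for w :: "nat \<Rightarrow> nat \<Rightarrow> nat"
  have X0: "X w \<ge> 0" for w unfolding X_def deviation_def by (intro sum_nonneg) simp
  have p0: "p w \<ge> 0" for w by (simp add: p_def)
  have D0: "D \<ge> 0" using v0 by (simp add: D_def)
  have err_meas: "error_event K N M n N0 H f g w \<in> sets (noise_measure K n M N0)" if "w \<in> ?\<Omega>" for w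
    using code that by (simp add: is_code_def)
  define S where "S w i' = (SOME S. S \<in> sets (PiM J (\<lambda>_. borel)) \<and>
      (\<forall>y\<in>S. \<forall>j<N. g i' (block n M y) j = w i' j) \<and>
      1 - p w \<le> measure (gauss_vec J (signal K N H f w i') (\<lambda>_. N0)) S)" for w i'
  have region: "S w i' \<in> sets (PiM J (\<lambda>_. borel)) \<and> (\<forall>y\<in>S w i'. \<forall>j<N. g i' (block n M y) j = w i' j) \<and>
      1 - p w \<le> measure (gauss_vec J (signal K N H f w i') (\<lambda>_. N0)) (S w i')"
    if "w \<in> ?\<Omega>" "i' < K" for w i'
    unfolding S_def
  proof (rule someI_ex, rule decoding_region[OF that(2) N0 err_meas[OF that(1)]], intro exI conjI ballI allI impI)
  qed (auto simp: p_def J_def)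
  then have S: "\<And>w i'. w \<in> ?\<Omega> \<Longrightarrow> i' < K \<Longrightarrow> S w i' \<in> sets (PiM J (\<lambda>_. borel))"
    "\<And>w i' y j. w \<in> ?\<Omega> \<Longrightarrow> i' < K \<Longrightarrow> y \<in> S w i' \<Longrightarrow> j < N \<Longrightarrow> g i' (block n M y) j = w i' j"
    "\<And>w i'. w \<in> ?\<Omega> \<Longrightarrow> i' < K \<Longrightarrow> 1 - p w \<le> measure (gauss_vec J (signal K N H f w i') (\<lambda>_. N0)) (S w i')"
    by blast+
  have fibre: "(\<Sum>w\<in>{w \<in> ?\<Omega>. \<zeta> w = u}. 1 - 2 * p w - X w / D) \<le> C" for u
  proof -
    define F where "F = {w \<in> ?\<Omega>. \<zeta> w = u \<and> X w \<le> D}"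
    have F: "finite F" and F\<Omega>: "\<And>w. w \<in> F \<Longrightarrow> w \<in> ?\<Omega>" and F\<zeta>: "\<And>w. w \<in> F \<Longrightarrow> \<zeta> w = u"
      using finite_msg_tuples by (auto simp: F_def)
    define T where "T q = H (k, k, l, snd q) / H (i, k, l, snd q)" for q :: "nat \<times> nat"
    define x where "x i' r q = background K N i k l H f u i' q
       + (\<Sum>j<N. H (i', i, j, snd q) * f i j (r j) (fst q))" for i' r and q :: "nat \<times> nat"
    \<comment> \<open>The regions in \<open>S\<close> depend on the whole tuple. Uniting them over
      the tuples of \<open>F\<close> that share the own-cell messages gives an event indexed by
      those messages alone; events for different messages are disjoint, since the decoder output at
      a common point determines the messages.\<close>
    define G where "G r = (\<Union>w\<in>{w \<in> F. w i = r}. S w i)" for r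
    define G' where "G' t = (\<Union>w\<in>{w \<in> F. w k l = t}. S w k)" for t
    have bg: "background K N i k l H f w i' q = background K N i k l H f u i' q" if "w \<in> F" for w i' q
      unfolding background_def F\<zeta>[OF that, symmetric] \<zeta>_def by (auto intro!: sum.cong)
    have sig: "signal K N H f w i' q = x i' (w i) q + H (i', k, l, snd q) * f k l (w k l) (fst q)"
      if "w \<in> F" for w i' q
      unfolding signal_split[OF idx] x_def bg[OF that] ..
    \<comment> \<open>Decoders only fix the entries with \<open>j < N\<close>; the remaining ones
      are 0 in every message tuple.\<close>
    have row: "w i = w' i" if "w \<in> ?\<Omega>" "w' \<in> ?\<Omega>" "\<And>j. j < N \<Longrightarrow> w i j = w' i j" for w w'
    proof
      fix j show "w i j = w' i j"
        using that idx by (cases "j < N") (auto simp: msg_tuples_def split: if_splits)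
    qed
    have inj: "inj_on (\<lambda>w. (w i, w k l)) F"
    proof (rule inj_onI)
      fix w w' assume w: "w \<in> F" "w' \<in> F" and "(w i, w k l) = (w' i, w' k l)"
      then have eq: "w i = w' i" "w k l = w' k l" by auto
      have "\<zeta> w = \<zeta> w'" using F\<zeta> w by simp
      then have "active i k l k' j \<or> w k' j = w' k' j" for k' j
        unfolding \<zeta>_def by (metis (full_types))
      then show "w = w'" using eq by (intro ext) (metis active_def)
    qed
    have two: "(\<Sum>w\<in>F. measure (gauss_vec J (signal K N H f w i) (\<lambda>_. N0)) (G (w i))
        + measure (gauss_vec J (signal K N H f w k) (\<lambda>_. N0)) (G' (w k l)) - 1)
        \<le> (exp 1 * v / s) ^ card J"
    \<comment> \<open>Once the own-cell messages \<open>r\<close> are known, scaling the signal at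
      station \<open>i\<close> by \<open>T\<close> matches the gain of user \<open>l\<close> at
      station \<open>k\<close>, and the shift \<open>e r\<close> corrects the known
      remainder.\<close>
    proof (rule two_stage_decoding_bound[where \<rho> = "\<lambda>w. w i" and \<tau> = "\<lambda>w. w k l" and T = T
          and e = "\<lambda>r q. x k r q - T q * x i r q" and c = "background K N i k l H f u i",
          OF F J inj s(1,2) _ v])
      show "s * (cmod (T q))\<^sup>2 < N0" if "q \<in> J" for q
        using that s(3) by (auto simp: T_def J_def)
      show "G r \<in> sets (PiM J (\<lambda>_. borel))" for r
        unfolding G_def using F F\<Omega> idx by (intro sets.finite_UN) (auto intro: S(1))
      show "G' t \<in> sets (PiM J (\<lambda>_. borel))" for t
        unfolding G'_def using F F\<Omega> idx by (intro sets.finite_UN) (auto intro: S(1))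
      show "disjoint_family_on G ((\<lambda>w. w i) ` F)"
        unfolding disjoint_family_on_def G_def
      proof (intro ballI impI, rule ccontr)
        fix r r' assume "r \<noteq> r'" and "(\<Union>w\<in>{w \<in> F. w i = r}. S w i) \<inter> (\<Union>w\<in>{w \<in> F. w i = r'}. S w i) \<noteq> {}"
        then obtain w w' y where w: "w \<in> F" "w' \<in> F" "w i = r" "w' i = r'" "y \<in> S w i" "y \<in> S w' i"
          by auto
        then have "w i = w' i"
          using F\<Omega> S(2) idx by (intro row) metis+
        with w \<open>r \<noteq> r'\<close> show False by simp
      qed
      show "disjoint_family_on G' ((\<lambda>w. w k l) ` F)"
        unfolding disjoint_family_on_def G'_def
      proof (intro ballI impI, rule ccontr)
        fix r r' assume "r \<noteq> r'" and "(\<Union>w\<in>{w \<in> F. w k l = r}. S w k) \<inter> (\<Union>w\<in>{w \<in> F. w k l = r'}. S w k) \<noteq> {}"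
        then obtain w w' y where w: "w \<in> F" "w' \<in> F" "w k l = r" "w' k l = r'" "y \<in> S w k" "y \<in> S w' k"
          by auto
        then have "w k l = w' k l"
          using F\<Omega> S(2) idx by metis
        with w \<open>r \<noteq> r'\<close> show False by simp
      qed
      show "signal K N H f w k q = x k (w i) q - T q * x i (w i) q + T q * signal K N H f w i q"
        if "w \<in> F" "q \<in> J" for w q
      proof -
        have "H (i, k, l, snd q) \<noteq> 0" using that nz by (auto simp: J_def)
        then show ?thesis
          unfolding sig[OF that(1)] T_def by (simp add: field_simps)
      qed
      show "(\<Sum>q\<in>J. (cmod (signal K N H f w i q - background K N i k l H f u i q))\<^sup>2)
          \<le> real (card J) * v / 2" if "w \<in> F" for w
        using that unfolding F_def X_def deviation_def D_def J_def[symmetric]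
        using bg[OF that] by simp
    qed
    have pN: "finite_measure (gauss_vec J a (\<lambda>_. N0))" for a
      using N0 by (intro prob_space.finite_measure prob_space_gauss_vec)
    have Gm: "G r \<in> sets (gauss_vec J a (\<lambda>_. N0))" "G' t \<in> sets (gauss_vec J a (\<lambda>_. N0))" for r t a
      unfolding G_def G'_def sets_gauss_vec using F F\<Omega> idx
      by (auto intro!: sets.finite_UN S(1))
    have "(\<Sum>w\<in>{w \<in> ?\<Omega>. \<zeta> w = u}. 1 - 2 * p w - X w / D) \<le> (\<Sum>w\<in>F. 1 - 2 * p w - X w / D)"
    proof -
      have "(\<Sum>w\<in>{w \<in> ?\<Omega>. \<zeta> w = u} - F. 1 - 2 * p w - X w / D) \<le> 0"
      proof (rule sum_nonpos)
        fix w assume "w \<in> {w \<in> ?\<Omega>. \<zeta> w = u} - F"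
        then have "X w > D" by (auto simp: F_def)
        \<comment> \<open>\<open>D\<close> vanishes only for an empty index set \<open>J\<close>,
          and then every deviation is 0 as well.\<close>
        moreover have "D \<noteq> 0"
        proof
          assume "D = 0"
          then have "J = {}" using v0 J by (auto simp: D_def)
          then have "X w = 0" by (simp add: X_def deviation_def J_def[symmetric])
          with \<open>D = 0\<close> \<open>X w > D\<close> show False by simp
        qed
        ultimately have "1 \<le> X w / D" using D0 by simp
        then show "1 - 2 * p w - X w / D \<le> 0" using p0[of w] by linarith
      qed
      moreover have "(\<Sum>w\<in>{w \<in> ?\<Omega>. \<zeta> w = u}. 1 - 2 * p w - X w / D)
          = (\<Sum>w\<in>{w \<in> ?\<Omega>. \<zeta> w = u} - F. 1 - 2 * p w - X w / D) + (\<Sum>w\<in>F. 1 - 2 * p w - X w / D)"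
        using finite_msg_tuples by (intro sum.subset_diff) (auto simp: F_def)
      ultimately show ?thesis by simp
    qed
    also have "\<dots> \<le> (\<Sum>w\<in>F. measure (gauss_vec J (signal K N H f w i) (\<lambda>_. N0)) (G (w i))
        + measure (gauss_vec J (signal K N H f w k) (\<lambda>_. N0)) (G' (w k l)) - 1)"
    proof (rule sum_mono)
      fix w assume w: "w \<in> F"
      have "1 - p w \<le> measure (gauss_vec J (signal K N H f w i) (\<lambda>_. N0)) (G (w i))"
        using w by (intro order.trans[OF S(3)[OF F\<Omega>[OF w] idx(1)]] finite_measure.finite_measure_mono[OF pN] Gm)
          (auto simp: G_def)
      moreover have "1 - p w \<le> measure (gauss_vec J (signal K N H f w k) (\<lambda>_. N0)) (G' (w k l))"
        using w by (intro order.trans[OF S(3)[OF F\<Omega>[OF w] idx(2)]] finite_measure.finite_measure_mono[OF pN] Gm)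
          (auto simp: G'_def)
      moreover have "X w / D \<ge> 0" using X0[of w] D0 by simp
      ultimately show "1 - 2 * p w - X w / D \<le> measure (gauss_vec J (signal K N H f w i) (\<lambda>_. N0)) (G (w i))
        + measure (gauss_vec J (signal K N H f w k) (\<lambda>_. N0)) (G' (w k l)) - 1" by linarith
    qed
    also have "\<dots> \<le> C" using two by (simp add: C_def cJ)
    finally show ?thesis .
  qed
  have L1: "\<And>k' j. k' < K \<Longrightarrow> j < N \<Longrightarrow> L k' j \<ge> 1" using code unfolding is_code_def by blast
  have \<Omega>0: "real (card ?\<Omega>) > 0"
    unfolding card_msg_tuples using L1 by (auto intro!: prod_pos simp: Suc_le_eq)
  \<comment> \<open>The doubled error term and the deviation term each take at most a quarter of the
    tuples. At least half remain, whence the factor 2 in the conclusion.\<close>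
  have "(\<Sum>w\<in>?\<Omega>. p w) \<le> real (card ?\<Omega>) / 8"
    using err \<Omega>0 unfolding err_prob_def p_def by (simp add: field_simps)
  moreover have "(\<Sum>w\<in>?\<Omega>. X w / D) \<le> real (card ?\<Omega>) / 4"
  proof (cases "D = 0")
    case False
    then have "D > 0" using D0 by simp
    have "(\<Sum>w\<in>?\<Omega>. X w) \<le> real (card ?\<Omega>) * (real (n * M) * (2 * h\<^sup>2 * ((real N)\<^sup>2 + 1) * P))"
      unfolding X_def using idx code h by (rule sum_deviation_le)
    also have "\<dots> = real (card ?\<Omega>) / 4 * D"
      by (simp add: D_def v_def cJ)
    finally show ?thesis using \<open>D > 0\<close> by (simp add: sum_divide_distrib[symmetric] field_simps)
  qed simp
  moreover have "(\<Sum>w\<in>?\<Omega>. 1 - 2 * p w - X w / D)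
      = real (card ?\<Omega>) - 2 * (\<Sum>w\<in>?\<Omega>. p w) - (\<Sum>w\<in>?\<Omega>. X w / D)"
    unfolding sum_subtractf sum_distrib_left by simp
  ultimately have "real (card ?\<Omega>) / 2 \<le> (\<Sum>w\<in>?\<Omega>. 1 - 2 * p w - X w / D)"
    by linarith
  \<comment> \<open>Each choice of inactive messages contributes at most \<open>C\<close>; the
    number of choices cancels against the same factor of \<open>card ?\<Omega>\<close>.\<close>
  also have "\<dots> = (\<Sum>u\<in>msg_tuples K N L'. \<Sum>w\<in>{w \<in> ?\<Omega>. \<zeta> w = u}. 1 - 2 * p w - X w / D)"
  proof (rule sum.group[symmetric, OF finite_msg_tuples finite_msg_tuples])
    show "\<zeta> ` ?\<Omega> \<subseteq> msg_tuples K N L'"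
    proof (rule image_subsetI)
      fix w assume w: "w \<in> ?\<Omega>"
      have "if k' < K \<and> j < N then \<zeta> w k' j < L' k' j else \<zeta> w k' j = 0" for k' j
      proof -
        have "if k' < K \<and> j < N then w k' j < L k' j else w k' j = 0"
          using w unfolding msg_tuples_def by blast
        then show ?thesis by (simp add: \<zeta>_def L'_def split: if_splits)
      qed
      then show "\<zeta> w \<in> msg_tuples K N L'" by (simp add: msg_tuples_def)
    qed
  qed
  also have "\<dots> \<le> (\<Sum>u\<in>msg_tuples K N L'. C)" by (intro sum_mono fibre)
  also have "\<dots> = real (card (msg_tuples K N L')) * C" by simp
  finally have main: "real (card ?\<Omega>) \<le> real (card (msg_tuples K N L')) * (2 * C)" by simp
  have card: "real (card ?\<Omega>) = real (card (msg_tuples K N L')) * ((\<Prod>j<N. real (L i j)) * real (L k l))"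
    unfolding L'_def by (subst card_msg_tuples_active[OF idx]) simp
  with \<Omega>0 have "real (card (msg_tuples K N L')) > 0"
    by (metis mult_zero_left of_nat_0_less_iff of_nat_0 gr0I less_irrefl)
  with main card show ?thesis by (simp add: C_def)
qed

section \<open>Rates and degrees of freedom\<close>

text \<open>A single code with error at most 1/8 is taken, and the logarithm of its size bound is
  divided by \<open>n\<close>. The factor 2 costs \<open>1 / n\<close>, at most 1.\<close>

lemma achievable_rates_bound:
  fixes N0 P h s :: real
  assumes idx: "i < K" "k < K" "i \<noteq> k" "l < N"
    and ach: "achievable_rates K N M N0 H P R"
    and h: "\<And>j m. j < N \<Longrightarrow> m < M \<Longrightarrow> cmod (H (i, i, j, m)) \<le> h" "\<And>m. m < M \<Longrightarrow> cmod (H (i, k, l, m)) \<le> h"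
    and nz: "\<And>m. m < M \<Longrightarrow> H (i, k, l, m) \<noteq> 0"
    and s: "0 < s" "s < N0" "\<And>m. m < M \<Longrightarrow> s * (cmod (H (k, k, l, m) / H (i, k, l, m)))\<^sup>2 < N0"
    and v_def: "v = 16 * h\<^sup>2 * ((real N)\<^sup>2 + 1) * P" and v: "2 * s \<le> v"
  shows "(\<Sum>j<N. R i j) + R k l \<le> 1 + real M * log 2 (exp 1 * v / s)"
proof -
  have "(1::real) / 8 > 0" by simp
  then obtain n0 where n0: "\<forall>n\<ge>n0. \<exists>L f g. is_code K N M n P N0 H L f g \<and>
      (\<forall>k<K. \<forall>j<N. real (L k j) \<ge> 2 powr (real n * R k j)) \<and> err_prob K N M n N0 H L f g \<le> 1 / 8"
    using ach unfolding achievable_rates_def by metis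
  \<comment> \<open>\<open>n0\<close> may be 0, and a positive block length is needed for the
    division.\<close>
  define n where "n = max n0 1"
  have n: "n \<ge> n0" "real n \<ge> 1" by (auto simp: n_def)
  from n0 n(1) obtain L f g where code: "is_code K N M n P N0 H L f g"
    and L: "\<And>k j. k < K \<Longrightarrow> j < N \<Longrightarrow> 2 powr (real n * R k j) \<le> real (L k j)"
    and err: "err_prob K N M n N0 H L f g \<le> 1 / 8" by metis
  let ?x = "exp 1 * v / s"
  have x: "?x > 0" using s v by simp
  have "2 powr (real n * ((\<Sum>j<N. R i j) + R k l))
      = (\<Prod>j<N. 2 powr (real n * R i j)) * 2 powr (real n * R k l)"
    by (simp add: powr_sum powr_add distrib_left sum_distrib_left)
  also have "\<dots> \<le> (\<Prod>j<N. real (L i j)) * real (L k l)"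
    using idx L by (intro mult_mono prod_mono prod_nonneg) auto
  also have "\<dots> \<le> 2 * ?x ^ (n * M)"
    using idx code err h nz s v_def v by (rule code_size_bound)
  finally have "log 2 (2 powr (real n * ((\<Sum>j<N. R i j) + R k l))) \<le> log 2 (2 * ?x ^ (n * M))"
    using x by (subst log_le_cancel_iff) auto
  moreover have "log 2 (2 * ?x ^ (n * M)) = 1 + real n * (real M * log 2 ?x)"
    using x by (subst log_mult_pos) (auto simp: log_nat_power)
  ultimately have "real n * ((\<Sum>j<N. R i j) + R k l) \<le> 1 + real n * (real M * log 2 ?x)"
    by simp
  also have "\<dots> \<le> real n * (1 + real M * log 2 ?x)"
    using n by (simp add: distrib_left)
  finally show ?thesis using n by simp
qed

text \<open>In the rate bound only \<open>v\<close> grows with the power, and linearly. After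
  division by \<open>log 2 (P / N0)\<close> the channel-dependent constants vanish in the limit and
  \<open>M\<close> remains.\<close>

lemma dof_pair_bound:
  fixes N0 :: real
  assumes idx: "i < K" "k < K" "i \<noteq> k" "l < N" and N0: "0 < N0"
    and dof: "dof_achievable K N M N0 H d"
    and nz: "\<And>m. m < M \<Longrightarrow> H (i, k, l, m) \<noteq> 0"
  shows "(\<Sum>j<N. d i j) + d k l \<le> real M"
proof -
  obtain R where R: "\<forall>\<^sub>F P in at_top. achievable_rates K N M N0 H P (R P)"
    and lim: "\<And>k j. k < K \<Longrightarrow> j < N \<Longrightarrow> ((\<lambda>P. R P k j / log 2 (P / N0)) \<longlongrightarrow> d k j) at_top"
    using dof unfolding dof_achievable_def by metis
  \<comment> \<open>A common bound for the gains involved; the leading 1 keeps \<open>B\<close>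
    positive.\<close>
  define h where "h = 1 + (\<Sum>j<N. \<Sum>m<M. cmod (H (i, i, j, m))) + (\<Sum>m<M. cmod (H (i, k, l, m)))"
  have h1: "h \<ge> 1" by (simp add: h_def sum_nonneg)
  have h_own: "cmod (H (i, i, j, m)) \<le> h" if "j < N" "m < M" for j m
  proof -
    have "cmod (H (i, i, j, m)) \<le> (\<Sum>m<M. cmod (H (i, i, j, m)))"
      using that by (intro member_le_sum) auto
    also have "\<dots> \<le> (\<Sum>j<N. \<Sum>m<M. cmod (H (i, i, j, m)))"
      using that by (intro member_le_sum[where f = "\<lambda>j. \<Sum>m<M. cmod (H (i, i, j, m))"]) (auto intro: sum_nonneg)
    finally show ?thesis unfolding h_def by (smt (verit) sum_nonneg norm_ge_zero)
  qed
  have h_int: "cmod (H (i, k, l, m)) \<le> h" if "m < M" for m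
  proof -
    have "cmod (H (i, k, l, m)) \<le> (\<Sum>m<M. cmod (H (i, k, l, m)))"
      using that by (intro member_le_sum[where f = "\<lambda>m. cmod (H (i, k, l, m))"]) auto
    moreover have "0 \<le> (\<Sum>j<N. \<Sum>m<M. cmod (H (i, i, j, m)))" by (intro sum_nonneg) auto
    ultimately show ?thesis unfolding h_def by linarith
  qed
  define c where "c m = (cmod (H (k, k, l, m) / H (i, k, l, m)))\<^sup>2" for m
  \<comment> \<open>Small enough to be below \<open>N0\<close>, both by itself and after scaling by
    any \<open>c m\<close>; the factor 2 makes these inequalities strict.\<close>
  define s where "s = N0 / (2 * (1 + (\<Sum>m<M. c m)))"
  have c0: "0 \<le> (\<Sum>m<M. c m)" by (auto simp: c_def intro: sum_nonneg)
  have s0: "s > 0" using N0 c0 by (simp add: s_def)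
  have eq: "s * (2 * (1 + (\<Sum>m<M. c m))) = N0" using c0 by (simp add: s_def)
  have sc: "s * c m < N0" if "m < M" for m
  proof -
    have "c m \<le> (\<Sum>m<M. c m)" using that by (intro member_le_sum) (auto simp: c_def)
    then have "s * c m < s * (2 * (1 + (\<Sum>m<M. c m)))"
      using s0 c0 by (intro mult_strict_left_mono) auto
    then show ?thesis using eq by simp
  qed
  have sN: "s < N0"
  proof -
    have "s * 1 < s * (2 * (1 + (\<Sum>m<M. c m)))"
      using s0 c0 by (intro mult_strict_left_mono) auto
    then show ?thesis using eq by simp
  qed
  define B where "B = 16 * h\<^sup>2 * ((real N)\<^sup>2 + 1)"
  have B: "B > 0" using h1 by (auto simp: B_def add_nonneg_pos)
  define A where "A = exp 1 * B / s"
  have A: "A > 0" using B s0 by (simp add: A_def)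
  have "\<forall>\<^sub>F P in at_top. ((\<Sum>j<N. R P i j) + R P k l) / log 2 (P / N0)
      \<le> (1 + real M * log 2 (A * P)) / log 2 (P / N0)"
    \<comment> \<open>The first threshold yields \<open>2 * s \<le> B * P\<close>, the second makes
      \<open>log 2 (P / N0)\<close> positive.\<close>
    using R eventually_ge_at_top[of "2 * s / B"] eventually_gt_at_top[of N0]
  proof eventually_elim
    case (elim P)
    have "(\<Sum>j<N. R P i j) + R P k l \<le> 1 + real M * log 2 (exp 1 * (B * P) / s)"
    proof (rule achievable_rates_bound[OF idx elim(1) h_own h_int nz s0 sN])
      show "s * (cmod (H (k, k, l, m) / H (i, k, l, m)))\<^sup>2 < N0" if "m < M" for m
        using sc[OF that] by (simp add: c_def)
      show "2 * s \<le> B * P" using elim B by (simp add: field_simps)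
    qed (auto simp: B_def)
    also have "exp 1 * (B * P) / s = A * P" by (simp add: A_def)
    finally show ?case
      using elim N0 by (intro divide_right_mono) (auto simp: field_simps)
  qed
  moreover have "((\<lambda>P. ((\<Sum>j<N. R P i j) + R P k l) / log 2 (P / N0))
      \<longlongrightarrow> (\<Sum>j<N. d i j) + d k l) at_top"
    unfolding add_divide_distrib sum_divide_distrib
    using idx by (intro tendsto_add tendsto_sum lim) auto
  moreover have "((\<lambda>P. (1 + real M * log 2 (A * P)) / log 2 (P / N0)) \<longlongrightarrow> real M) at_top"
    using A N0 by real_asymp
  ultimately show ?thesis
    by (intro tendsto_le[of at_top]) auto
qed

text \<open>The generic property of the channel behind the almost sure statement: finitely many
  gains, each with a law that has a density.\<close>

lemma AE_channel_nonzero: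
  "AE H in channel_measure K N M. \<forall>q\<in>{..<K} \<times> {..<K} \<times> {..<N} \<times> {..<M}. H q \<noteq> 0"
  unfolding channel_measure_def
  by (intro AE_finite_allI AE_PiM_component prob_space_cgauss AE_cgauss_nonzero) auto

theorem theorem2:
  fixes K N M :: nat and N0 :: real
  assumes "K \<ge> 2" and "N \<ge> 1" and "N0 > 0"
  shows "AE H in channel_measure K N M.
           \<forall>d. dof_achievable K N M N0 H d \<longrightarrow>
             (\<Sum>i<K. \<Sum>j<N. d i j) \<le> real K * real N * real M / (real N + 1)"
  using AE_channel_nonzero
proof (eventually_elim, intro allI impI)
  fix H :: "nat \<times> nat \<times> nat \<times> nat \<Rightarrow> complex" and d :: "nat \<Rightarrow> nat \<Rightarrow> real"
  assume nz: "\<forall>q\<in>{..<K} \<times> {..<K} \<times> {..<N} \<times> {..<M}. H q \<noteq> 0"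
    and dof: "dof_achievable K N M N0 H d"
  define \<sigma> where "\<sigma> i = (if Suc i = K then 0 else Suc i)" for i
  have \<sigma>: "\<sigma> i < K" "i \<noteq> \<sigma> i" if "i < K" for i
    using that assms(1) by (auto simp: \<sigma>_def)
  have bij: "bij_betw \<sigma> {..<K} {..<K}"
    by (rule bij_betw_byWitness[where f' = "\<lambda>i. if i = 0 then K - 1 else i - 1"])
       (use assms(1) in \<open>auto simp: \<sigma>_def\<close>)
  let ?D = "\<Sum>i<K. \<Sum>j<N. d i j"
  \<comment> \<open>Summing over \<open>l\<close> counts the total of cell \<open>i\<close>
    \<open>N\<close> times and that of its successor once; since \<open>\<sigma>\<close> is a
    permutation, this adds up to \<open>(N + 1) * ?D\<close> over all cells.\<close>
  have "(\<Sum>i<K. \<Sum>l<N. (\<Sum>j<N. d i j) + d (\<sigma> i) l) \<le> (\<Sum>i<K. \<Sum>l<N. real M)"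
    using nz \<sigma> by (intro sum_mono dof_pair_bound[OF _ _ _ _ assms(3) dof]) auto
  moreover have "(\<Sum>i<K. \<Sum>l<N. d (\<sigma> i) l) = ?D"
    using sum.reindex_bij_betw[OF bij, of "\<lambda>i. \<Sum>l<N. d i l"] .
  ultimately have "(real N + 1) * ?D \<le> real K * real N * real M"
    by (simp add: sum.distrib sum_distrib_left[symmetric] algebra_simps)
  then show "?D \<le> real K * real N * real M / (real N + 1)"
    by (simp add: field_simps)
qed

end
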